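(* Let $D=\{z\in\mathbb{C}:|z|<1\}$ and let $\varphi$ be an automorphism of $D$ (a biholomorphic map of $D$ onto itself). Then the composition operator $C_\varphi f=f\circ\varphi$ is complex symmetric on the Hardy space $H^2(D)$ if and only if $\varphi$ is either a rotation or an elliptic automorphism of order two.
   Context: $H^2(D)$ is the Hardy-Hilbert space of analytic functions $f$ on $D$ with $\|f\|^2=\sup_{0<r<1}\int_0^{2\pi}|f(re^{i\theta})|^2\frac{d\theta}{2\pi}<\infty$, with its usual inner product (for which $\{z^k\}_{k\ge0}$ is an orthonormal basis). For an analytic self-map $\varphi$ of $D$, $C_\varphi$ is bounded on $H^2(D)$. A conjugation on a complex Hilbert space $\mathcal{H}$ is a conjugate-linear, isometric map $C:\mathcal{H}\to\mathcal{H}$ with $C^2=I$. A bounded operator $T$ on $\mathcal{H}$ is complex symmetric if there exists a conjugation $C$ on $\mathcal{H}$ such that $T=CT^*C$. A rotation is a map $z\mapsto \zeta z$ with $|\zeta|=1$. An automorphism of $D$ is elliptic if it has a unique fixed point in $D$. The order of an elliptic automorphism $\varphi$ is the smallest positive integer $n$ such that the $n$-th iterate $\varphi\circ\cdots\circ\varphi$ is the identity on $D$, and is $\infty$ if no such $n$ exists. *)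

theory Defs
  imports "HOL-Complex_Analysis.Complex_Analysis" "HOL-Library.Extended_Nat"
begin

section \<open>Operators on Hilbert spaces of complex-valued functions\<close>

text \<open>
  A Hilbert space is given here by its carrier \<open>H\<close>, a set of functions closed under the pointwise
  vector space operations, and its inner product \<open>ip\<close>, which is linear in the first argument and
  conjugate-linear in the second. Operators are total functions that only matter on \<open>H\<close>.
\<close>

definition ip_norm :: "('f \<Rightarrow> 'f \<Rightarrow> complex) \<Rightarrow> 'f \<Rightarrow> real" where
  "ip_norm ip f = sqrt (Re (ip f f))"

definition bounded_operator_on ::
    "('x \<Rightarrow> complex) set \<Rightarrow> (('x \<Rightarrow> complex) \<Rightarrow> ('x \<Rightarrow> complex) \<Rightarrow> complex) \<Rightarrow>
     (('x \<Rightarrow> complex) \<Rightarrow> ('x \<Rightarrow> complex)) \<Rightarrow> bool" where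
  "bounded_operator_on H ip T \<longleftrightarrow>
     (\<forall>f\<in>H. T f \<in> H) \<and>
     (\<forall>f\<in>H. \<forall>g\<in>H. T (\<lambda>x. f x + g x) = (\<lambda>x. T f x + T g x)) \<and>
     (\<forall>c. \<forall>f\<in>H. T (\<lambda>x. c * f x) = (\<lambda>x. c * T f x)) \<and>
     (\<exists>B. \<forall>f\<in>H. ip_norm ip (T f) \<le> B * ip_norm ip f)"

definition conjugation_on ::
    "('x \<Rightarrow> complex) set \<Rightarrow> (('x \<Rightarrow> complex) \<Rightarrow> ('x \<Rightarrow> complex) \<Rightarrow> complex) \<Rightarrow>
     (('x \<Rightarrow> complex) \<Rightarrow> ('x \<Rightarrow> complex)) \<Rightarrow> bool" where
  "conjugation_on H ip C \<longleftrightarrow>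
     (\<forall>f\<in>H. C f \<in> H) \<and>
     (\<forall>f\<in>H. \<forall>g\<in>H. C (\<lambda>x. f x + g x) = (\<lambda>x. C f x + C g x)) \<and>
     (\<forall>c. \<forall>f\<in>H. C (\<lambda>x. c * f x) = (\<lambda>x. cnj c * C f x)) \<and>
     (\<forall>f\<in>H. ip_norm ip (C f) = ip_norm ip f) \<and>
     (\<forall>f\<in>H. C (C f) = f)"

text \<open>
  The adjoint is stated as a relation: for a bounded operator \<open>T\<close> on a Hilbert space there is,
  up to values outside \<open>H\<close>, exactly one \<open>S\<close> with \<open>is_adjoint_on H ip T S\<close>, namely \<open>T*\<close>.
\<close>

definition is_adjoint_on ::
    "'f set \<Rightarrow> ('f \<Rightarrow> 'f \<Rightarrow> complex) \<Rightarrow> ('f \<Rightarrow> 'f) \<Rightarrow> ('f \<Rightarrow> 'f) \<Rightarrow> bool" where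
  "is_adjoint_on H ip T S \<longleftrightarrow>
     (\<forall>g\<in>H. S g \<in> H) \<and> (\<forall>f\<in>H. \<forall>g\<in>H. ip (T f) g = ip f (S g))"

definition complex_symmetric_on ::
    "('x \<Rightarrow> complex) set \<Rightarrow> (('x \<Rightarrow> complex) \<Rightarrow> ('x \<Rightarrow> complex) \<Rightarrow> complex) \<Rightarrow>
     (('x \<Rightarrow> complex) \<Rightarrow> ('x \<Rightarrow> complex)) \<Rightarrow> bool" where
  "complex_symmetric_on H ip T \<longleftrightarrow>
     bounded_operator_on H ip T \<and>
     (\<exists>C S. conjugation_on H ip C \<and> is_adjoint_on H ip T S \<and> (\<forall>f\<in>H. T f = C (S (C f))))"


section \<open>The Hardy space of the unit disc\<close>

abbreviation unit_disc :: "complex set" where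
  "unit_disc \<equiv> ball 0 1"

text \<open>
  A function on the disc is represented by its extension by \<open>0\<close> to the whole plane, so that
  equality in \<open>hardy2\<close> is equality on the disc.
\<close>

definition hardy2 :: "(complex \<Rightarrow> complex) set" where
  "hardy2 = {f. f holomorphic_on unit_disc \<and> (\<forall>z. z \<notin> unit_disc \<longrightarrow> f z = 0) \<and>
     bdd_above ((\<lambda>r. integral {0..2*pi} (\<lambda>\<theta>. (cmod (f (of_real r * cis \<theta>)))\<^sup>2 / (2*pi)))
                  ` {0<..<1})}"

text \<open>
  The integral means in the definition of \<open>hardy2\<close> increase with \<open>r\<close>, so their supremum is
  their limit for \<open>r \<rightarrow> 1\<close>; the inner product is the corresponding limit of sesquilinear forms.
  Hence \<open>ip_norm hardy2_inner f\<close> is the square root of that supremum, and the monomials are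
  orthonormal.
\<close>

definition hardy2_inner :: "(complex \<Rightarrow> complex) \<Rightarrow> (complex \<Rightarrow> complex) \<Rightarrow> complex" where
  "hardy2_inner f g =
     Lim (at_left 1) (\<lambda>r::real. integral {0..2*pi}
       (\<lambda>\<theta>. f (of_real r * cis \<theta>) * cnj (g (of_real r * cis \<theta>)) / of_real (2*pi)))"

definition composition_operator ::
    "(complex \<Rightarrow> complex) \<Rightarrow> (complex \<Rightarrow> complex) \<Rightarrow> (complex \<Rightarrow> complex)" where
  "composition_operator \<phi> f = (\<lambda>z. if z \<in> unit_disc then f (\<phi> z) else 0)"


section \<open>Automorphisms of the unit disc\<close>

text \<open>In this section the values of \<open>\<phi>\<close> outside the disc are irrelevant.\<close>

definition disc_automorphism :: "(complex \<Rightarrow> complex) \<Rightarrow> bool" where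
  "disc_automorphism \<phi> \<longleftrightarrow>
     \<phi> holomorphic_on unit_disc \<and> \<phi> ` unit_disc \<subseteq> unit_disc \<and>
     (\<exists>\<psi>. \<psi> holomorphic_on unit_disc \<and> \<psi> ` unit_disc \<subseteq> unit_disc \<and>
        (\<forall>z\<in>unit_disc. \<psi> (\<phi> z) = z \<and> \<phi> (\<psi> z) = z))"

definition disc_rotation :: "(complex \<Rightarrow> complex) \<Rightarrow> bool" where
  "disc_rotation \<phi> \<longleftrightarrow> (\<exists>\<zeta>. cmod \<zeta> = 1 \<and> (\<forall>z\<in>unit_disc. \<phi> z = \<zeta> * z))"

definition elliptic_automorphism :: "(complex \<Rightarrow> complex) \<Rightarrow> bool" where
  "elliptic_automorphism \<phi> \<longleftrightarrow> disc_automorphism \<phi> \<and> (\<exists>!z. z \<in> unit_disc \<and> \<phi> z = z)"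

definition automorphism_order :: "(complex \<Rightarrow> complex) \<Rightarrow> enat" where
  "automorphism_order \<phi> =
     (if \<exists>n>0. \<forall>z\<in>unit_disc. (\<phi> ^^ n) z = z
      then enat (LEAST n. 0 < n \<and> (\<forall>z\<in>unit_disc. (\<phi> ^^ n) z = z))
      else \<infinity>)"

end

theory Submission
  imports Defs
begin

text \<open>
  Every automorphism of the disc has the form \<open>z \<mapsto> (p z + q) / (cnj q z + cnj p)\<close> with
  \<open>\<bar>p\<bar>\<^sup>2 - \<bar>q\<bar>\<^sup>2 = 1\<close>. It is unimodular on the circle, so the Gram matrix of its powers
  is Toeplitz with geometrically decaying entries; this makes \<open>C\<^sub>\<phi>\<close> bounded.

  Rotations give diagonal operators, symmetric with respect to conjugating the Taylor coefficients.
  If \<open>\<phi>\<close> has order two, then \<open>T = C\<^sub>\<phi>\<close> is an involution; the unitary factor \<open>U\<close> of its polar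
  decomposition is self-adjoint and satisfies \<open>T U = U T\<^sup>*\<close>, and \<open>C = U J\<close> works, where \<open>J\<close> is
  induced by a reflection of the disc that commutes with \<open>\<phi>\<close>.

  Conversely let \<open>T = C T\<^sup>* C\<close>. If \<open>\<phi>\<close> is not elliptic, then \<open>g = C 1\<close> is fixed by \<open>T\<^sup>*\<close>.
  With \<open>\<phi>\<^sub>n\<close> the \<open>n\<close>-th iterate and \<open>c = \<phi>\<^sub>n(0)\<close>,
  \<open>\<langle>z\<^sup>k\<^sup>+\<^sup>1 - c z\<^sup>k, g\<rangle> = \<langle>\<phi>\<^sub>n\<^sup>k\<^sup>+\<^sup>1 - c \<phi>\<^sub>n\<^sup>k, g\<rangle>\<close>, and the norm on the right is
  \<open>(1 - \<bar>c\<bar>\<^sup>2)\<^sup>1\<^sup>/\<^sup>2\<close>, which tends to \<open>0\<close>. Hence all coefficients of \<open>g\<close> have the same modulus,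
  which is absurd. If \<open>\<phi>\<close> fixes \<open>a \<noteq> 0\<close> with multiplier \<open>\<mu>\<close>, then the powers \<open>e\<^sub>n\<close> of an automorphism
  that maps \<open>a\<close> to \<open>0\<close> are eigenvectors of \<open>T\<close> for \<open>\<mu>\<^sup>n\<close>, and the relations between
  \<open>\<langle>C e\<^sub>m, e\<^sub>n\<rangle>\<close> and the dual eigenvectors of \<open>T\<^sup>*\<close> are contradictory unless \<open>\<mu>\<^sup>2 = 1\<close>.
\<close>

section \<open>Square summable sequences\<close>

text \<open>A type rather than a set, so that the classes of real inner product spaces and Banach
  spaces apply to it, and with them \<open>blinfun\<close> and \<open>Banach_fix\<close>.\<close>

typedef l2 = "{x :: nat \<Rightarrow> complex. summable (\<lambda>n. (cmod (x n))\<^sup>2)}"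
  morphisms coord Abs_l2
  by (rule exI[of _ "\<lambda>_. 0"]) simp

setup_lifting type_definition_l2

lemma l2_eqI: "(\<And>n. coord x n = coord y n) \<Longrightarrow> x = y"
  by (rule coord_inject[THEN iffD1]) (rule ext)

lemma summable_coord: "summable (\<lambda>n. (cmod (coord x n))\<^sup>2)"
  using coord[of x] by simp

lemma coord_Abs: "summable (\<lambda>n. (cmod (f n))\<^sup>2) \<Longrightarrow> coord (Abs_l2 f) = f"
  by (simp add: Abs_l2_inverse)

lemma power2_norm_add_le: "(cmod (x + y))\<^sup>2 \<le> 2 * (cmod x)\<^sup>2 + 2 * (cmod y)\<^sup>2"
proof -
  have "(cmod (x + y))\<^sup>2 \<le> (cmod x + cmod y)\<^sup>2"
    by (intro power_mono norm_triangle_ineq norm_ge_zero)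
  also have "\<dots> \<le> 2 * (cmod x)\<^sup>2 + 2 * (cmod y)\<^sup>2"
    using sum_squares_bound[of "cmod x" "cmod y"] by (simp add: power2_sum)
  finally show ?thesis .
qed

lemma summable_norm_add:
  assumes "summable (\<lambda>n. (cmod (f n))\<^sup>2)" "summable (\<lambda>n. (cmod (g n))\<^sup>2)"
  shows "summable (\<lambda>n. (cmod (f n + g n))\<^sup>2)"
  by (rule summable_comparison_test'[where N = 0 and g = "\<lambda>n. 2 * (cmod (f n))\<^sup>2 + 2 * (cmod (g n))\<^sup>2"])
     (use assms in \<open>auto intro!: summable_add summable_mult power2_norm_add_le\<close>)

lemma summable_norm_cmult:
  assumes "summable (\<lambda>n. (cmod (f n))\<^sup>2)"
  shows "summable (\<lambda>n. (cmod (c * f n))\<^sup>2)"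
  using summable_mult[OF assms, of "(cmod c)\<^sup>2"] by (simp add: norm_mult power_mult_distrib)

lemma summable_cmod_mult:
  assumes "summable (\<lambda>n. (cmod (f n))\<^sup>2)" "summable (\<lambda>n. (cmod (g n))\<^sup>2)"
  shows "summable (\<lambda>n. cmod (f n) * cmod (g n))"
proof (rule summable_comparison_test'[where N = 0])
  show "summable (\<lambda>n. (cmod (f n))\<^sup>2 + (cmod (g n))\<^sup>2)"
    using assms by (rule summable_add)
  show "norm (cmod (f n) * cmod (g n)) \<le> (cmod (f n))\<^sup>2 + (cmod (g n))\<^sup>2" for n
  proof -
    have "0 \<le> cmod (f n) * cmod (g n)" by simp
    moreover have "2 * (cmod (f n) * cmod (g n)) \<le> (cmod (f n))\<^sup>2 + (cmod (g n))\<^sup>2"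
      using sum_squares_bound[of "cmod (f n)" "cmod (g n)"] by (simp add: mult.assoc)
    ultimately show ?thesis unfolding real_norm_def by linarith
  qed
qed

text \<open>Those classes know real scalars only; the complex structure is carried by
  \<open>sc\<close>.\<close>

lift_definition sc :: "complex \<Rightarrow> l2 \<Rightarrow> l2" is "\<lambda>c x n. c * x n"
  by (simp add: summable_norm_cmult)

instantiation l2 :: real_inner
begin

lift_definition zero_l2 :: l2 is "\<lambda>_. 0" by simp
lift_definition plus_l2 :: "l2 \<Rightarrow> l2 \<Rightarrow> l2" is "\<lambda>x y n. x n + y n"
  by (simp add: summable_norm_add)
lift_definition uminus_l2 :: "l2 \<Rightarrow> l2" is "\<lambda>x n. - x n" by simp
lift_definition minus_l2 :: "l2 \<Rightarrow> l2 \<Rightarrow> l2" is "\<lambda>x y n. x n - y n"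
  subgoal for f g using summable_norm_add[of f "\<lambda>n. - g n"] by simp
  done
lift_definition scaleR_l2 :: "real \<Rightarrow> l2 \<Rightarrow> l2" is "\<lambda>c x n. c *\<^sub>R x n"
  by (simp add: summable_norm_cmult scaleR_conv_of_real del: norm_mult)

text \<open>The real part of the complex inner product \<open>cip\<close> introduced below.\<close>

definition inner_l2 :: "l2 \<Rightarrow> l2 \<Rightarrow> real" where
  "inner_l2 x y = (\<Sum>n. coord x n \<bullet> coord y n)"
definition norm_l2 :: "l2 \<Rightarrow> real" where "norm_l2 x = sqrt (inner x x)"
definition dist_l2 :: "l2 \<Rightarrow> l2 \<Rightarrow> real" where "dist_l2 x y = norm (x - y)"
definition sgn_l2 :: "l2 \<Rightarrow> l2" where "sgn_l2 x = scaleR (inverse (norm x)) x"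
definition uniformity_l2 :: "(l2 \<times> l2) filter" where
  "uniformity_l2 = (INF e\<in>{0<..}. principal {(x, y). dist x y < e})"
definition open_l2 :: "l2 set \<Rightarrow> bool" where
  "open_l2 U = (\<forall>x\<in>U. eventually (\<lambda>(x', y). x' = x \<longrightarrow> y \<in> U) uniformity)"

lemma summable_inner_coord: "summable (\<lambda>n. coord x n \<bullet> coord y n)"
  by (rule summable_rabs_cancel, rule summable_comparison_test'[where N = 0,
        OF summable_cmod_mult[OF summable_coord[of x] summable_coord[of y]]])
     (simp add: Cauchy_Schwarz_ineq2)

instance
proof
  fix x y z :: l2 and r s :: real
  show "dist x y = norm (x - y)" "sgn x = inverse (norm x) *\<^sub>R x" "norm x = sqrt (inner x x)"
    by (simp_all add: dist_l2_def sgn_l2_def norm_l2_def)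
  show "x + y + z = x + (y + z)" "x + y = y + x" "0 + x = x" "- x + x = 0" "x - y = x + - y"
    by (transfer; simp add: fun_eq_iff)+
  show "r *\<^sub>R (x + y) = r *\<^sub>R x + r *\<^sub>R y" "(r + s) *\<^sub>R x = r *\<^sub>R x + s *\<^sub>R x"
       "r *\<^sub>R s *\<^sub>R x = (r * s) *\<^sub>R x" "1 *\<^sub>R x = x"
    by (transfer; simp add: fun_eq_iff algebra_simps scaleR_conv_of_real)+
  show "uniformity = (INF e\<in>{0<..}. principal {(x :: l2, y). dist x y < e})"
    by (rule uniformity_l2_def)
  show "open U = (\<forall>x\<in>U. eventually (\<lambda>(x', y). x' = x \<longrightarrow> y \<in> U) uniformity)" for U :: "l2 set"
    by (rule open_l2_def)
  show "inner x y = inner y x"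
    by (simp add: inner_l2_def inner_commute)
  show "inner (x + y) z = inner x z + inner y z"
    by (simp add: inner_l2_def plus_l2.rep_eq inner_add_left suminf_add summable_inner_coord)
  show "inner (r *\<^sub>R x) y = r * inner x y"
    by (simp add: inner_l2_def scaleR_l2.rep_eq suminf_mult summable_inner_coord)
  show "0 \<le> inner x x"
    by (simp add: inner_l2_def suminf_nonneg summable_inner_coord)
  show "inner x x = 0 \<longleftrightarrow> x = 0"
  proof
    assume "inner x x = 0"
    then have "\<forall>n. coord x n \<bullet> coord x n = 0"
      unfolding inner_l2_def by (subst (asm) suminf_eq_zero_iff) (auto simp: summable_inner_coord)
    then show "x = 0" by (intro l2_eqI) (simp add: zero_l2.rep_eq)
  qed (simp add: inner_l2_def zero_l2.rep_eq)
qed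

end

lemma coord_simps [simp]:
  "coord 0 n = 0" "coord (x + y) n = coord x n + coord y n" "coord (- x) n = - coord x n"
  "coord (x - y) n = coord x n - coord y n" "coord (r *\<^sub>R x) n = r *\<^sub>R coord x n"
  "coord (sc c x) n = c * coord x n"
  by (simp_all add: zero_l2.rep_eq plus_l2.rep_eq uminus_l2.rep_eq minus_l2.rep_eq
      scaleR_l2.rep_eq sc.rep_eq)

lemma norm_l2_power2: "(norm x)\<^sup>2 = (\<Sum>n. (cmod (coord x n))\<^sup>2)"
  by (simp add: power2_norm_eq_inner inner_l2_def)

lemma sum_coord_le: "(\<Sum>n<N. (cmod (coord x n))\<^sup>2) \<le> (norm x)\<^sup>2"
  unfolding norm_l2_power2 by (rule sum_le_suminf) (auto simp: summable_coord)

lemma norm_coord_le: "cmod (coord x n) \<le> norm x"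
proof -
  have "(cmod (coord x n))\<^sup>2 \<le> (\<Sum>k<Suc n. (cmod (coord x k))\<^sup>2)"
    by (simp add: sum_nonneg)
  also have "\<dots> \<le> (norm x)\<^sup>2" by (rule sum_coord_le)
  finally show ?thesis by (rule power2_le_imp_le) simp
qed

text \<open>The device by which elements of \<open>l2\<close> are produced later: limits of Cauchy
  sequences, values of adjoints, and Taylor coefficients.\<close>

lemma l2_from_bounded_sums:
  assumes "\<And>N. (\<Sum>n<N. (cmod (f n))\<^sup>2) \<le> B\<^sup>2" "0 \<le> B"
  shows "\<exists>x. coord x = f \<and> norm x \<le> B"
proof -
  have s: "summable (\<lambda>n. (cmod (f n))\<^sup>2)"
    using assms(1) by (intro summableI_nonneg_bounded[where x = "B\<^sup>2"]) auto
  have "(norm (Abs_l2 f))\<^sup>2 \<le> B\<^sup>2"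
    unfolding norm_l2_power2 coord_Abs[OF s] by (rule suminf_le_const[OF s assms(1)])
  then show ?thesis using coord_Abs[OF s] assms(2) power2_le_imp_le by blast
qed

instance l2 :: complete_space
proof
  fix X :: "nat \<Rightarrow> l2" assume X: "Cauchy X"
  have "Cauchy (\<lambda>m. coord (X m) n)" for n
    unfolding Cauchy_def dist_norm
  proof (intro allI impI)
    fix e :: real assume "e > 0"
    then obtain M where "\<forall>m\<ge>M. \<forall>k\<ge>M. norm (X m - X k) < e"
      using X unfolding Cauchy_def dist_norm by blast
    then show "\<exists>M. \<forall>m\<ge>M. \<forall>k\<ge>M. cmod (coord (X m) n - coord (X k) n) < e"
      by (metis coord_simps(4) le_less_trans norm_coord_le)
  qed
  then have "\<exists>l. (\<lambda>m. coord (X m) n) \<longlonglongrightarrow> l" for n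
    unfolding convergent_def[symmetric] by (rule Cauchy_convergent)
  then obtain l where l: "\<And>n. (\<lambda>m. coord (X m) n) \<longlonglongrightarrow> l n" by metis
  \<comment> \<open>The coordinatewise limit \<open>l\<close> is not yet known to be square
    summable. Its difference from \<open>X m\<close> is: the partial sums for
    \<open>X m - X k\<close> are bounded by \<open>e\<^sup>2\<close>, and the bound survives
    \<open>k\<close> tending to infinity.\<close>
  have key: "\<exists>M. \<forall>m\<ge>M. \<exists>d. coord d = (\<lambda>n. coord (X m) n - l n) \<and> norm d \<le> e" if "e > 0" for e
  proof -
    obtain M where M: "\<And>m k. m \<ge> M \<Longrightarrow> k \<ge> M \<Longrightarrow> norm (X m - X k) < e"
      using X \<open>e > 0\<close> unfolding Cauchy_def dist_norm by blast
    have "\<exists>d. coord d = (\<lambda>n. coord (X m) n - l n) \<and> norm d \<le> e" if m: "m \<ge> M" for m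
    proof (rule l2_from_bounded_sums)
      fix N
      have "(\<lambda>k. \<Sum>n<N. (cmod (coord (X m - X k) n))\<^sup>2) \<longlonglongrightarrow> (\<Sum>n<N. (cmod (coord (X m) n - l n))\<^sup>2)"
        unfolding coord_simps by (intro tendsto_intros l)
      moreover have "\<forall>\<^sub>F k in sequentially. (\<Sum>n<N. (cmod (coord (X m - X k) n))\<^sup>2) \<le> e\<^sup>2"
        using eventually_ge_at_top[of M]
      proof eventually_elim
        case (elim k)
        have "(norm (X m - X k))\<^sup>2 \<le> e\<^sup>2" using M[OF m elim] by (intro power_mono) auto
        with sum_coord_le[of "X m - X k" N] show ?case by linarith
      qed
      ultimately show "(\<Sum>n<N. (cmod (coord (X m) n - l n))\<^sup>2) \<le> e\<^sup>2"
        by (rule tendsto_upperbound) simp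
    qed (use \<open>e > 0\<close> in simp)
    then show ?thesis by blast
  qed
  obtain m d where d: "coord d = (\<lambda>n. coord (X m) n - l n)"
    using key[of 1] by auto
  define L where "L = X m - d"
  have L: "coord L n = l n" for n by (simp add: L_def d)
  have "X \<longlonglongrightarrow> L"
  proof (rule LIMSEQ_I)
    fix e :: real assume "e > 0"
    then obtain M where M: "\<forall>m\<ge>M. \<exists>d. coord d = (\<lambda>n. coord (X m) n - l n) \<and> norm d \<le> e / 2"
      using key[of "e/2"] by auto
    have "norm (X k - L) < e" if "k \<ge> M" for k
    proof -
      from M that obtain d where d: "coord d = (\<lambda>n. coord (X k) n - l n)" "norm d \<le> e / 2" by blast
      then have "d = X k - L" by (intro l2_eqI) (simp add: L)
      with d(2) \<open>e > 0\<close> show ?thesis by simp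
    qed
    then show "\<exists>no. \<forall>n\<ge>no. norm (X n - L) < e" by blast
  qed
  then show "convergent X" by (auto simp: convergent_def)
qed

instance l2 :: banach ..

section \<open>Complex inner product and Cauchy-Schwarz inequality\<close>

definition cip :: "l2 \<Rightarrow> l2 \<Rightarrow> complex" where
  "cip x y = (\<Sum>n. coord x n * cnj (coord y n))"

lemma summable_norm_coord_mult_cnj: "summable (\<lambda>n. norm (coord x n * cnj (coord y n)))"
  using summable_cmod_mult[OF summable_coord[of x] summable_coord[of y]] by (simp add: norm_mult)

lemma summable_coord_mult_cnj: "summable (\<lambda>n. coord x n * cnj (coord y n))"
  by (rule summable_norm_cancel[OF summable_norm_coord_mult_cnj])

lemma Re_cip: "Re (cip x y) = inner x y"
  unfolding cip_def inner_l2_def Re_suminf[OF summable_coord_mult_cnj]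
  by (simp add: inner_complex_def)

lemma cip_add_left: "cip (x + y) z = cip x z + cip y z"
  and cip_add_right: "cip z (x + y) = cip z x + cip z y"
  and cip_diff_left: "cip (x - y) z = cip x z - cip y z"
  and cip_diff_right: "cip z (x - y) = cip z x - cip z y"
  by (simp_all add: cip_def distrib_right distrib_left left_diff_distrib right_diff_distrib
      suminf_add suminf_diff summable_coord_mult_cnj)

lemma cip_sc_left: "cip (sc c x) y = c * cip x y"
  and cip_sc_right: "cip x (sc c y) = cnj c * cip x y"
  using suminf_mult[OF summable_coord_mult_cnj[of x y], of c]
    suminf_mult[OF summable_coord_mult_cnj[of x y], of "cnj c"]
  by (simp_all add: cip_def mult.assoc mult.left_commute)

lemma cip_zero [simp]: "cip 0 x = 0" "cip x 0 = 0"
  by (simp_all add: cip_def)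

lemmas cip_simps = cip_add_left cip_add_right cip_diff_left cip_diff_right cip_sc_left cip_sc_right

lemma cnj_cip: "cnj (cip x y) = cip y x"
  unfolding cip_def
  by (subst bounded_linear.suminf[OF bounded_linear_cnj summable_coord_mult_cnj]) (simp add: mult.commute)

lemma cip_self: "cip x x = complex_of_real ((norm x)\<^sup>2)"
  using Re_cip[of x x] cnj_cip[of x x]
  by (simp add: complex_eq_iff power2_norm_eq_inner)

lemma cip_self_eq_0 [simp]: "cip x x = 0 \<longleftrightarrow> x = 0"
  by (simp add: cip_self)

lemma Im_cip: "Im (cip x y) = inner x (sc \<i> y)"
  by (simp add: Re_cip[symmetric] cip_simps)

lemma sc_simps [simp]: "sc c (sc d x) = sc (c * d) x" "sc 1 x = x" "sc c (x + y) = sc c x + sc c y"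
  "sc c (x - y) = sc c x - sc c y" "sc c 0 = 0" "sc 0 x = 0"
  by (auto intro!: l2_eqI simp: algebra_simps)

lemma scaleR_sc: "r *\<^sub>R x = sc (of_real r) x"
  by (auto intro!: l2_eqI simp: scaleR_conv_of_real)

lemma norm_sc: "norm (sc c x) = cmod c * norm x"
proof -
  have "cip (sc c x) (sc c x) = (c * cnj c) * cip x x"
    by (simp add: cip_simps)
  also have "\<dots> = of_real ((cmod c * norm x)\<^sup>2)"
    unfolding cip_self complex_norm_square[symmetric] of_real_mult[symmetric] power_mult_distrib ..
  finally have "(norm (sc c x))\<^sup>2 = (cmod c * norm x)\<^sup>2"
    unfolding cip_self of_real_eq_iff .
  then show ?thesis
    by (simp add: power2_eq_iff_nonneg)
qed

lemma bounded_linear_sc: "bounded_linear (sc c)"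
  by (rule bounded_linear_intro[where K = "cmod c"])
     (simp_all add: scaleR_sc norm_sc mult.commute)

lemma norm_cip_le: "cmod (cip x y) \<le> norm x * norm y"
proof -
  \<comment> \<open>The phase of \<open>cip x y\<close>, or \<open>0\<close> if that is
    \<open>0\<close>. Multiplying \<open>y\<close> by it makes the inner product real and
    nonnegative, so the real Cauchy-Schwarz inequality applies.\<close>
  define u where "u = (if cip x y = 0 then 0 else cip x y / cmod (cip x y))"
  have u: "cmod u \<le> 1" by (simp add: u_def norm_divide)
  have "of_real (cmod z) = cnj (z / cmod z) * z" if "z \<noteq> 0" for z
  proof -
    have "cnj z * z = of_real (cmod z) * of_real (cmod z)"
      by (metis complex_norm_square mult.commute power2_eq_square of_real_power)
    with that show ?thesis by (simp add: field_simps)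
  qed
  then have "of_real (cmod (cip x y)) = cip x (sc u y)"
    by (cases "cip x y = 0") (auto simp: cip_simps u_def)
  then have "cmod (cip x y) = inner x (sc u y)"
    by (metis Re_cip Re_complex_of_real)
  also have "\<dots> \<le> norm x * norm (sc u y)" by (rule norm_cauchy_schwarz)
  also have "\<dots> \<le> norm x * norm y"
    using u by (intro mult_left_mono) (simp_all add: norm_sc mult_left_le_one_le)
  finally show ?thesis .
qed

lemma bounded_linear_cip_left: "bounded_linear (\<lambda>x. cip x y)"
  by (rule bounded_linear_intro[where K = "norm y"])
     (simp_all add: cip_simps scaleR_sc norm_cip_le scaleR_conv_of_real)

section \<open>Orthonormal basis, truncations and adjoints\<close>

lift_definition basis_l2 :: "nat \<Rightarrow> l2" is "\<lambda>k n. if n = k then 1 else 0"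
  by (rule summable_finite[of "{_}"]) auto

lemma coord_basis [simp]: "coord (basis_l2 k) n = (if n = k then 1 else 0)"
  by (simp add: basis_l2.rep_eq)

lemma cip_basis_left: "cip (basis_l2 k) x = cnj (coord x k)"
proof -
  have "cip (basis_l2 k) x = (\<Sum>n\<in>{k}. coord (basis_l2 k) n * cnj (coord x n))"
    unfolding cip_def by (rule suminf_finite) auto
  then show ?thesis by simp
qed

lemma cip_basis_right: "cip x (basis_l2 k) = coord x k"
  using cnj_cip[of "basis_l2 k" x] by (simp add: cip_basis_left)

definition trunc :: "nat \<Rightarrow> l2 \<Rightarrow> l2" where
  "trunc N x = (\<Sum>k<N. sc (coord x k) (basis_l2 k))"

lemma coord_sum: "coord (\<Sum>k\<in>A. f k) n = (\<Sum>k\<in>A. coord (f k) n)"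
  by (induction A rule: infinite_finite_induct) auto

lemma coord_trunc [simp]: "coord (trunc N x) n = (if n < N then coord x n else 0)"
  by (auto simp: trunc_def coord_sum if_distrib[of "\<lambda>u. _ * u"] cong: if_cong)

lemma norm_trunc_power2: "(norm (trunc N x))\<^sup>2 = (\<Sum>n<N. (cmod (coord x n))\<^sup>2)"
  unfolding norm_l2_power2 by (subst suminf_finite[of "{..<N}"]) auto

lemma trunc_tendsto: "(\<lambda>N. trunc N x) \<longlonglongrightarrow> x"
proof -
  have "(\<lambda>N. (norm x)\<^sup>2 - (\<Sum>n<N. (cmod (coord x n))\<^sup>2)) \<longlonglongrightarrow> (norm x)\<^sup>2 - (norm x)\<^sup>2"
    unfolding norm_l2_power2
    by (intro tendsto_diff tendsto_const summable_LIMSEQ summable_coord)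
  moreover have "(norm (trunc N x - x))\<^sup>2 = (norm x)\<^sup>2 - (\<Sum>n<N. (cmod (coord x n))\<^sup>2)" for N
  proof -
    have "cip (trunc N x) (trunc N x - x) = 0"
      unfolding cip_def by (subst suminf_finite[of "{}"]) auto
    then have "inner (trunc N x) (trunc N x - x) = 0" by (simp add: Re_cip[symmetric])
    then have "(norm x)\<^sup>2 = (norm (trunc N x))\<^sup>2 + (norm (trunc N x - x))\<^sup>2"
      by (simp add: power2_norm_eq_inner inner_diff_left inner_diff_right inner_commute)
    then show ?thesis by (simp add: norm_trunc_power2)
  qed
  ultimately have "(\<lambda>N. (norm (trunc N x - x))\<^sup>2) \<longlonglongrightarrow> 0" by simp
  then have "(\<lambda>N. sqrt ((norm (trunc N x - x))\<^sup>2)) \<longlonglongrightarrow> sqrt 0" by (rule tendsto_real_sqrt)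
  then show ?thesis by (simp add: tendsto_norm_zero_iff LIM_zero_iff)
qed

text \<open>The truncations are finite combinations of basis vectors and converge to
  \<open>x\<close>. The scalar \<open>c\<close> is part of the hypothesis because
  \<open>bounded_linear\<close> means real linearity.\<close>

lemma bounded_linear_eqI:
  assumes "bounded_linear F" "bounded_linear G" "\<And>k c. F (sc c (basis_l2 k)) = G (sc c (basis_l2 k))"
  shows "F x = G x"
proof -
  interpret F: bounded_linear F by fact
  interpret G: bounded_linear G by fact
  have "(\<lambda>N. F (trunc N x)) \<longlonglongrightarrow> F x" "(\<lambda>N. G (trunc N x)) \<longlonglongrightarrow> G x"
    by (intro F.tendsto G.tendsto trunc_tendsto)+
  moreover have "F (trunc N x) = G (trunc N x)" for N
    by (simp add: trunc_def F.sum G.sum assms(3))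
  ultimately show ?thesis
    using LIMSEQ_unique[of "\<lambda>N. F (trunc N x)" "F x" "G x"] by simp
qed

text \<open>The coordinates of \<open>S y\<close> are forced to be
  \<open>cip y (T (basis_l2 m))\<close>; the main point is that they are square summable.\<close>

lemma adjoint_l2_exists:
  assumes "bounded_linear T" and lin: "\<And>c x. T (sc c x) = sc c (T x)"
  obtains S where "bounded_linear S" "\<And>c x. S (sc c x) = sc c (S x)"
    "\<And>x y. cip (T x) y = cip x (S y)"
proof -
  interpret T: bounded_linear T by fact
  obtain K where K: "K > 0" "\<And>x. norm (T x) \<le> norm x * K" using T.pos_bounded by blast
  have ex: "\<exists>z. coord z = (\<lambda>m. cip y (T (basis_l2 m))) \<and> norm z \<le> K * norm y" for y
  proof (rule l2_from_bounded_sums)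
    fix N
    define c where "c m = cip y (T (basis_l2 m))" for m
    \<comment> \<open>The truncation of the vector sought. Testing with it gives
      \<open>(norm w)\<^sup>2 = cip y (T w)\<close>, which is at most
      \<open>norm y * K * norm w\<close>; cancelling \<open>norm w\<close> bounds the partial
      sum.\<close>
    define w where "w = (\<Sum>m<N. sc (c m) (basis_l2 m))"
    have cw: "coord w n = (if n < N then c n else 0)" for n
      by (auto simp: w_def coord_sum if_distrib[of "\<lambda>u. _ * u"] cong: if_cong)
    have nw: "(norm w)\<^sup>2 = (\<Sum>n<N. (cmod (c n))\<^sup>2)"
      unfolding norm_l2_power2 by (subst suminf_finite[of "{..<N}"]) (auto simp: cw)
    have "cip y (T w) = (\<Sum>n<N. of_real ((cmod (c n))\<^sup>2))"
    proof -
      have "cip y (\<Sum>m\<in>A. f m) = (\<Sum>m\<in>A. cip y (f m))" for A :: "nat set" and f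
        by (induction A rule: infinite_finite_induct) (auto simp: cip_simps)
      then show ?thesis
        by (simp add: w_def T.sum lin cip_simps c_def[symmetric] complex_norm_square mult.commute
            del: of_real_power)
    qed
    then have "of_real ((norm w)\<^sup>2) = cip y (T w)" by (simp add: nw)
    then have "(norm w)\<^sup>2 = cmod (cip y (T w))"
      by (metis norm_of_real abs_of_nonneg zero_le_power2)
    also have "\<dots> \<le> norm y * norm (T w)" by (rule norm_cip_le)
    also have "\<dots> \<le> norm y * (norm w * K)" by (intro mult_left_mono K) simp
    finally have "norm w * norm w \<le> norm w * (K * norm y)" by (simp add: power2_eq_square mult_ac)
    then have "norm w \<le> K * norm y" using K(1) by (cases "norm w = 0") auto
    then have "(norm w)\<^sup>2 \<le> (K * norm y)\<^sup>2" by (intro power_mono) auto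
    then show "(\<Sum>n<N. (cmod (cip y (T (basis_l2 n))))\<^sup>2) \<le> (K * norm y)\<^sup>2"
      by (simp add: nw c_def)
  qed (use K in simp)
  then obtain S where S: "\<And>y. coord (S y) = (\<lambda>m. cip y (T (basis_l2 m)))" "\<And>y. norm (S y) \<le> K * norm y"
    by metis
  have Ssc: "S (sc c x) = sc c (S x)" for c x
    by (rule l2_eqI) (simp add: S cip_simps)
  have "bounded_linear S"
    by (rule bounded_linear_intro[where K = K])
       (auto intro!: l2_eqI simp: S cip_simps scaleR_sc mult.commute S(2))
  moreover have "cip (T x) y = cip x (S y)" for x y
  proof (rule bounded_linear_eqI[of "\<lambda>x. cip (T x) y" "\<lambda>x. cip x (S y)"])
    show "bounded_linear (\<lambda>x. cip (T x) y)"
      using bounded_linear_compose[OF bounded_linear_cip_left assms(1)] .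
    show "cip (T (sc c (basis_l2 k))) y = cip (sc c (basis_l2 k)) (S y)" for k c
      by (simp add: lin cip_simps cip_basis_left S cnj_cip)
  qed (rule bounded_linear_cip_left)
  ultimately show ?thesis using that Ssc by blast
qed

section \<open>Polar decomposition of involutions\<close>

definition self_adjoint :: "('a::real_inner \<Rightarrow>\<^sub>L 'a) \<Rightarrow> bool" where
  "self_adjoint A \<longleftrightarrow> (\<forall>x y. A x \<bullet> y = x \<bullet> A y)"

text \<open>\<open>1 - Y\<close> is the square root of \<open>1 - X\<close>.\<close>

lemma contraction_fixed_point:
  fixes X :: "'a::{real_inner, banach} \<Rightarrow>\<^sub>L 'a"
  assumes "norm X < 1" "self_adjoint X"
  obtains Y where "norm Y \<le> norm X" "self_adjoint Y" "2 *\<^sub>R Y = X + (Y o\<^sub>L Y)"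
    "\<And>Z. Z o\<^sub>L X = X o\<^sub>L Z \<Longrightarrow> Z o\<^sub>L Y = Y o\<^sub>L Z"
proof -
  \<comment> \<open>\<open>f Y = Y\<close> is equivalent to \<open>(1 - Y)\<^sup>2 = 1 - X\<close>.
    The Banach theorem is applied on the closed set \<open>S\<close>, so that the fixed point
    inherits the norm bound, the symmetry and the commutation with everything that commutes with
    \<open>X\<close>. On \<open>S\<close> the map \<open>f\<close> contracts by
    \<open>norm X\<close>.\<close>
  define S where "S = {Y :: 'a \<Rightarrow>\<^sub>L 'a. norm Y \<le> norm X \<and> (\<forall>x y. blinfun_apply Y x \<bullet> y = x \<bullet> blinfun_apply Y y) \<and>
    (\<forall>Z. Z o\<^sub>L X = X o\<^sub>L Z \<longrightarrow> Z o\<^sub>L Y = Y o\<^sub>L Z)}"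
  define f where "f Y = (1/2) *\<^sub>R (X + (Y o\<^sub>L Y))" for Y :: "'a \<Rightarrow>\<^sub>L 'a"
  have "closed S"
    unfolding S_def
    by (intro closed_Collect_conj closed_Collect_all closed_Collect_imp closed_Collect_le
        closed_Collect_eq open_Collect_const continuous_intros
        bounded_bilinear.continuous_on[OF bounded_bilinear_blinfun_compose])
  then have "complete S" by (simp add: complete_eq_closed)
  moreover have "0 \<in> S" by (simp add: S_def)
  moreover have fS: "f Y \<in> S" if "Y \<in> S" for Y
  proof -
    have Y: "norm Y \<le> norm X" "\<And>x y. Y x \<bullet> y = x \<bullet> Y y"
      "\<And>Z. Z o\<^sub>L X = X o\<^sub>L Z \<Longrightarrow> Z o\<^sub>L Y = Y o\<^sub>L Z"
      using that by (auto simp: S_def)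
    have "norm (f Y) \<le> (norm X + norm Y * norm Y) / 2"
      using norm_triangle_ineq[of X "Y o\<^sub>L Y"] norm_blinfun_compose[of Y Y] by (simp add: f_def)
    also have "norm Y * norm Y \<le> norm X * 1"
      using Y(1) assms(1) by (intro mult_mono) auto
    finally have "norm (f Y) \<le> norm X" by simp
    moreover have "f Y x \<bullet> y = x \<bullet> f Y y" for x y
      using assms(2) Y(2)
      by (simp add: f_def blinfun.add_left blinfun.scaleR_left inner_add_left inner_add_right self_adjoint_def)
    moreover have "Z o\<^sub>L f Y = f Y o\<^sub>L Z" if "Z o\<^sub>L X = X o\<^sub>L Z" for Z
    proof (rule blinfun_eqI)
      fix x
      have "Z (X x) = X (Z x)" "Z (Y (Y x)) = Y (Y (Z x))"
        using that Y(3)[OF that] by (metis blinfun_apply_blinfun_compose)+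
      then show "(Z o\<^sub>L f Y) x = (f Y o\<^sub>L Z) x"
        by (simp add: f_def blinfun.add_left blinfun.scaleR_left blinfun.add_right blinfun.scaleR_right)
    qed
    ultimately show ?thesis by (simp add: S_def)
  qed
  moreover have "dist (f Y) (f W) \<le> norm X * dist Y W" if "Y \<in> S" "W \<in> S" for Y W
  proof -
    have "f Y - f W = (1/2) *\<^sub>R ((Y o\<^sub>L (Y - W)) + ((Y - W) o\<^sub>L W))"
      by (rule blinfun_eqI)
         (simp add: f_def blinfun.add_left blinfun.scaleR_left blinfun.diff_left blinfun.diff_right algebra_simps)
    then have "norm (f Y - f W) \<le> (norm Y * norm (Y - W) + norm (Y - W) * norm W) / 2"
      using norm_triangle_ineq[of "Y o\<^sub>L (Y - W)" "(Y - W) o\<^sub>L W"]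
        norm_blinfun_compose[of Y "Y - W"] norm_blinfun_compose[of "Y - W" W] by simp
    also have "\<dots> \<le> (norm X * norm (Y - W) + norm (Y - W) * norm X) / 2"
      using that by (intro divide_right_mono add_mono mult_mono) (auto simp: S_def)
    finally show ?thesis by (simp add: dist_norm mult.commute)
  qed
  ultimately have "\<exists>!Y. Y \<in> S \<and> f Y = Y"
    using assms(1) by (intro Banach_fix[of S "norm X" f]) auto
  then obtain Y where Y: "Y \<in> S" "f Y = Y" by blast
  have "2 *\<^sub>R Y = 2 *\<^sub>R f Y" using Y(2) by simp
  then have "2 *\<^sub>R Y = X + (Y o\<^sub>L Y)" by (simp add: f_def)
  with Y(1) show ?thesis using that[of Y] unfolding S_def self_adjoint_def by blast
qed

text \<open>Scaling by \<open>M\<close> makes \<open>X = 1 - A / M\<close> a strict contraction.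
  With \<open>(1 - Y)\<^sup>2 = 1 - X\<close>, the operator \<open>K = sqrt M (1 - Y)\<close>
  squares to \<open>A\<close>, and it is positive because \<open>norm Y < 1\<close>.\<close>

lemma positive_root:
  fixes A :: "'a::{real_inner, banach} \<Rightarrow>\<^sub>L 'a"
  assumes "self_adjoint A" "M > 0" "norm (id_blinfun - (1/M) *\<^sub>R A) < 1"
  obtains K where "self_adjoint K" "\<And>x. K (K x) = A x" "\<And>x. x \<noteq> 0 \<Longrightarrow> K x \<bullet> x > 0"
    "\<And>Z. Z o\<^sub>L A = A o\<^sub>L Z \<Longrightarrow> Z o\<^sub>L K = K o\<^sub>L Z"
proof -
  define X where "X = id_blinfun - (1/M) *\<^sub>R A"
  have Xa: "X x = x - (1/M) *\<^sub>R A x" for x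
    by (simp add: X_def blinfun.diff_left blinfun.scaleR_left)
  have "self_adjoint X"
    using assms(1) by (simp add: self_adjoint_def Xa inner_diff_left inner_diff_right)
  with assms(3) obtain Y where Y: "norm Y \<le> norm X" "self_adjoint Y" "2 *\<^sub>R Y = X + (Y o\<^sub>L Y)"
    "\<And>Z. Z o\<^sub>L X = X o\<^sub>L Z \<Longrightarrow> Z o\<^sub>L Y = Y o\<^sub>L Z"
    unfolding X_def[symmetric] using contraction_fixed_point by blast
  define K where "K = sqrt M *\<^sub>R (id_blinfun - Y)"
  have Ka: "K x = sqrt M *\<^sub>R (x - Y x)" for x
    by (simp add: K_def blinfun.diff_left blinfun.scaleR_left)
  show ?thesis
  proof (rule that)
    show "self_adjoint K"
      using Y(2) by (simp add: self_adjoint_def Ka inner_diff_left inner_diff_right)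
    show "K (K x) = A x" for x
    proof -
      have "2 *\<^sub>R Y x = X x + Y (Y x)"
        using arg_cong[OF Y(3), of "\<lambda>B. blinfun_apply B x"] by (simp add: blinfun.add_left blinfun.scaleR_left)
      then have "x - Y x - (Y x - Y (Y x)) = (1/M) *\<^sub>R A x"
        by (simp add: Xa scaleR_2 algebra_simps)
      moreover have "K (K x) = M *\<^sub>R (x - Y x - (Y x - Y (Y x)))"
        using \<open>M > 0\<close> by (simp add: Ka blinfun.scaleR_right blinfun.diff_right scaleR_diff_right)
      ultimately show ?thesis using \<open>M > 0\<close> by simp
    qed
    show "K x \<bullet> x > 0" if "x \<noteq> 0" for x
    proof -
      have "Y x \<bullet> x \<le> norm (Y x) * norm x" by (rule norm_cauchy_schwarz)
      also have "\<dots> \<le> (norm Y * norm x) * norm x" by (intro mult_right_mono norm_blinfun) simp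
      also have "\<dots> < 1 * (norm x * norm x)"
        unfolding mult.assoc using Y(1) assms(3) that by (intro mult_strict_right_mono) (auto simp: X_def)
      finally have "(x - Y x) \<bullet> x > 0"
        by (simp add: inner_diff_left power2_norm_eq_inner[symmetric] power2_eq_square)
      then show ?thesis using \<open>M > 0\<close> by (simp add: Ka)
    qed
    show "Z o\<^sub>L K = K o\<^sub>L Z" if "Z o\<^sub>L A = A o\<^sub>L Z" for Z
    proof -
      have "Z (A x) = A (Z x)" for x using that by (metis blinfun_apply_blinfun_compose)
      then have "Z o\<^sub>L X = X o\<^sub>L Z"
        by (intro blinfun_eqI) (simp add: Xa blinfun.diff_right blinfun.scaleR_right)
      then have "Z (Y x) = Y (Z x)" for x using Y(4) by (metis blinfun_apply_blinfun_compose)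
      then show ?thesis
        by (intro blinfun_eqI) (simp add: Ka blinfun.diff_right blinfun.scaleR_right)
    qed
  qed
qed

text \<open>
  The operator \<open>U\<close> is the unitary factor in the polar decomposition \<open>T = U (T\<^sup>* T)\<^sup>1\<^sup>/\<^sup>2\<close>; for an
  involution \<open>T\<close> the uniqueness of positive square roots forces \<open>U\<close> to be self-adjoint.
\<close>

lemma involution_polar_factor:
  fixes T Ts :: "'a::{real_inner, banach} \<Rightarrow>\<^sub>L 'a"
  assumes TT: "\<And>x. T (T x) = x" and adj: "\<And>x y. T x \<bullet> y = x \<bullet> Ts y"
  obtains U where "self_adjoint U" "\<And>x. U (U x) = x" "\<And>x. T (U x) = U (Ts x)"
    "\<And>Z. Z o\<^sub>L T = T o\<^sub>L Z \<Longrightarrow> Z o\<^sub>L Ts = Ts o\<^sub>L Z \<Longrightarrow> Z o\<^sub>L U = U o\<^sub>L Z"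
proof -
  have adj': "Ts x \<bullet> y = x \<bullet> T y" for x y by (metis adj inner_commute)
  have ST: "Ts (Ts x) = x" for x
  proof -
    have "(Ts (Ts x) - x) \<bullet> y = 0" for y
      by (simp add: inner_diff_left adj' TT)
    then show ?thesis by (metis inner_eq_zero_iff right_minus_eq)
  qed
  define A where "A = Ts o\<^sub>L T"
  have Aa: "A x = Ts (T x)" for x by (simp add: A_def)
  have "self_adjoint A" by (simp add: self_adjoint_def Aa adj adj')
  \<comment> \<open>Large enough for both
    \<open>(norm x)\<^sup>2 \<le> M * (norm (T x))\<^sup>2\<close>, which uses that \<open>T\<close>
    is its own inverse, and
    \<open>(norm (A x))\<^sup>2 \<le> M * (norm (T x))\<^sup>2\<close>.\<close>
  define M where "M = 1 + (norm T)\<^sup>2 + (norm Ts)\<^sup>2"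
  have M: "M \<ge> 1" "(norm T)\<^sup>2 \<le> M" "(norm Ts)\<^sup>2 \<le> M" by (auto simp: M_def)
  \<comment> \<open>Expanding \<open>(norm (x - A x / M))\<^sup>2\<close> and inserting these two
    bounds leaves at most \<open>(1 - 1 / M\<^sup>2) * (norm x)\<^sup>2\<close>.\<close>
  define \<rho> where "\<rho> = sqrt (1 - 1 / M\<^sup>2)"
  have M2: "1 / M\<^sup>2 \<le> 1" "0 < 1 / M\<^sup>2" using M(1) by auto
  have "norm ((id_blinfun - (1/M) *\<^sub>R A) x) \<le> \<rho> * norm x" for x
  proof -
    have tx: "(norm x)\<^sup>2 \<le> M * (norm (T x))\<^sup>2"
    proof -
      have "norm x \<le> norm T * norm (T x)" using norm_blinfun[of T "T x"] by (simp add: TT)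
      then have "(norm x)\<^sup>2 \<le> (norm T * norm (T x))\<^sup>2" by (intro power_mono) auto
      also have "\<dots> \<le> M * (norm (T x))\<^sup>2"
        unfolding power_mult_distrib by (intro mult_right_mono M) simp
      finally show ?thesis .
    qed
    have ax: "(norm (A x))\<^sup>2 \<le> M * (norm (T x))\<^sup>2"
    proof -
      have "norm (A x) \<le> norm Ts * norm (T x)" using norm_blinfun[of Ts "T x"] by (simp add: Aa)
      then have "(norm (A x))\<^sup>2 \<le> (norm Ts * norm (T x))\<^sup>2" by (intro power_mono) auto
      also have "\<dots> \<le> M * (norm (T x))\<^sup>2"
        unfolding power_mult_distrib by (intro mult_right_mono M) simp
      finally show ?thesis .
    qed
    have xa: "x \<bullet> A x = (norm (T x))\<^sup>2"
      by (simp add: Aa adj[symmetric] power2_norm_eq_inner)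
    have "(norm (x - (1/M) *\<^sub>R A x))\<^sup>2 = (norm x)\<^sup>2 - 2 * (norm (T x))\<^sup>2 / M + (norm (A x))\<^sup>2 / M\<^sup>2"
    proof -
      have "(norm (x - a))\<^sup>2 = (norm x)\<^sup>2 - 2 * (x \<bullet> a) + (norm a)\<^sup>2" for a
        by (simp add: power2_norm_eq_inner inner_diff_left inner_diff_right inner_commute)
      then show ?thesis
        by (simp add: xa power_divide)
    qed
    also have "\<dots> \<le> (norm x)\<^sup>2 - 2 * (norm (T x))\<^sup>2 / M + (norm (T x))\<^sup>2 / M"
    proof -
      have "(norm (A x))\<^sup>2 / M\<^sup>2 \<le> M * (norm (T x))\<^sup>2 / M\<^sup>2"
        by (intro divide_right_mono ax) simp
      also have "\<dots> = (norm (T x))\<^sup>2 / M" using M(1) by (simp add: power2_eq_square)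
      finally show ?thesis by simp
    qed
    also have "\<dots> = (norm x)\<^sup>2 - M * (norm (T x))\<^sup>2 / M\<^sup>2"
      using M(1) by (simp add: power2_eq_square)
    also have "\<dots> \<le> (norm x)\<^sup>2 - (norm x)\<^sup>2 / M\<^sup>2"
      by (intro diff_left_mono divide_right_mono tx) simp
    also have "\<dots> = (\<rho> * norm x)\<^sup>2"
      using M2 by (simp add: \<rho>_def power_mult_distrib algebra_simps)
    finally have "norm (x - (1/M) *\<^sub>R A x) \<le> \<rho> * norm x"
      using M2 by (elim power2_le_imp_le) (simp add: \<rho>_def)
    then show ?thesis by (simp add: blinfun.diff_left blinfun.scaleR_left)
  qed
  then have "norm (id_blinfun - (1/M) *\<^sub>R A) \<le> \<rho>"
    using M2 by (intro norm_blinfun_bound) (auto simp: \<rho>_def)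
  also have "\<rho> < 1" using M2 by (simp add: \<rho>_def)
  finally obtain K where K: "self_adjoint K" "\<And>x. K (K x) = A x" "\<And>x. x \<noteq> 0 \<Longrightarrow> K x \<bullet> x > 0"
    "\<And>Z. Z o\<^sub>L A = A o\<^sub>L Z \<Longrightarrow> Z o\<^sub>L K = K o\<^sub>L Z"
    using positive_root[OF \<open>self_adjoint A\<close>, of M] M(1) by (metis less_le_trans zero_less_one)
  have Ks: "K x \<bullet> y = x \<bullet> K y" for x y using K(1) by (simp add: self_adjoint_def)
  have KK: "K (K x) = Ts (T x)" for x by (simp add: K(2) Aa)
  have KA: "K (Ts (T x)) = Ts (T (K x))" for x by (simp add: KK[symmetric])
  \<comment> \<open>\<open>T\<close> and \<open>Ts\<close> are involutions, so \<open>T Ts\<close>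
    is the inverse of \<open>Ts T\<close>, and \<open>K\<close> commutes with it as well.\<close>
  have KB: "K (T (Ts x)) = T (Ts (K x))" for x
  proof -
    have "K x = Ts (T (K (T (Ts x))))" by (simp add: KA[symmetric] TT ST)
    then show ?thesis by (simp add: TT ST)
  qed
  have Kcomm: "Z (K x) = K (Z x)" if "\<And>x. Z (Ts (T x)) = Ts (T (Z x))" for Z :: "'a \<Rightarrow>\<^sub>L 'a" and x
  proof -
    have "Z o\<^sub>L A = A o\<^sub>L Z" by (intro blinfun_eqI) (simp add: Aa that)
    from K(4)[OF this] show ?thesis by (metis blinfun_apply_blinfun_compose)
  qed
  \<comment> \<open>Two positive square roots of \<open>T Ts\<close>, the second being the inverse
    of \<open>K\<close>. Their equality is what makes \<open>U\<close> self-adjoint.\<close>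
  define N where "N = T o\<^sub>L K o\<^sub>L T"
  define L where "L = T o\<^sub>L Ts o\<^sub>L K"
  have Na: "N x = T (K (T x))" and La: "L x = T (Ts (K x))" for x by (simp_all add: N_def L_def)
  \<comment> \<open>Written as \<open>Ts K\<^sup>3 T\<close>, the operator \<open>N\<close> is
    visibly positive.\<close>
  have N2: "N x = Ts (K (K (K (T x))))" for x by (simp add: KK KA Na ST)
  have Npos: "N x \<bullet> x \<ge> 0" for x
  proof -
    have "N x \<bullet> x = K (K (T x)) \<bullet> K (T x)" by (simp add: N2 adj' Ks)
    then show ?thesis using K(3)[of "K (T x)"] by (cases "K (T x) = 0") auto
  qed
  have KL: "K (L x) = x" for x by (simp add: La KB KK TT ST)
  have Lpos: "L x \<bullet> x > 0" if "x \<noteq> 0" for x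
  proof -
    have "L x \<noteq> 0" using KL[of x] that by (metis blinfun.zero_right)
    then show ?thesis using K(3)[of "L x"] KL[of x] by (simp add: inner_commute)
  qed
  have NN: "N (N x) = T (Ts x)" for x by (simp add: Na TT KK)
  have LL: "L (L x) = T (Ts x)" for x by (simp add: La KB KK TT ST)
  have NB: "N (T (Ts x)) = T (Ts (N x))" for x by (simp add: NN[symmetric])
  have NA: "N (Ts (T x)) = Ts (T (N x))" for x
  proof -
    have "T (Ts (N (Ts (T x)))) = N x" by (simp add: NB[symmetric] TT ST)
    then show ?thesis by (metis TT ST)
  qed
  have NL: "N (L x) = L (N x)" for x
    by (simp add: La NB Kcomm[OF NA])
  have NeqL: "N x = L x" for x
  proof (rule ccontr)
    assume "N x \<noteq> L x"
    \<comment> \<open>Uniqueness of the root: \<open>N\<close> and \<open>L\<close> commute and have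
      the same square, so \<open>(N + L) (N - L) = 0\<close>. Positivity of \<open>N\<close> and
      strict positivity of \<open>L\<close> then force \<open>d = 0\<close>.\<close>
    define d where "d = N x - L x"
    have "N d + L d = 0" by (simp add: d_def blinfun.diff_right NN LL NL)
    then have "N d \<bullet> d + L d \<bullet> d = 0" by (simp add: inner_add_left[symmetric])
    with Npos[of d] Lpos[of d] \<open>N x \<noteq> L x\<close> show False by (auto simp: d_def)
  qed
  have KT: "K (T x) = Ts (K x)" for x
    using NeqL[of x] unfolding Na La by (metis TT)
  \<comment> \<open>The polar factor is \<open>T\<close> composed with the inverse \<open>L\<close>
    of \<open>K\<close>, and \<open>T L = Ts K\<close> because \<open>T T = 1\<close>.\<close>
  define U where "U = Ts o\<^sub>L K"
  have Ua: "U x = Ts (K x)" for x by (simp add: U_def)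
  show ?thesis
  proof (rule that[of U])
    show "self_adjoint U" by (simp add: self_adjoint_def Ua adj' Ks KT)
    show "U (U x) = x" for x by (simp add: Ua KT[symmetric] KK ST TT)
    show "T (U x) = U (Ts x)" for x by (simp add: Ua KT[symmetric] KB)
    show "Z o\<^sub>L U = U o\<^sub>L Z" if "Z o\<^sub>L T = T o\<^sub>L Z" "Z o\<^sub>L Ts = Ts o\<^sub>L Z" for Z
    proof -
      have "Z (T x) = T (Z x)" "Z (Ts x) = Ts (Z x)" for x
        using that by (metis blinfun_apply_blinfun_compose)+
      moreover from this have "Z (K x) = K (Z x)" for x by (intro Kcomm) simp
      ultimately show ?thesis by (intro blinfun_eqI) (simp add: Ua)
    qed
  qed
qed

section \<open>Taylor coefficients of Hardy functions\<close>

lemma has_integral_circle_monomials: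
  "((\<lambda>\<theta>. (of_real r * cis \<theta>) ^ m * cnj ((of_real r * cis \<theta>) ^ n)) has_integral
     (if m = n then of_real (2 * pi) * of_real r ^ (2 * n) else 0)) {0..2*pi}"
proof -
  define k where "k = real m - real n"
  have eq: "(of_real r * cis \<theta>) ^ m * cnj ((of_real r * cis \<theta>) ^ n)
      = of_real r ^ (m + n) * exp (\<i> * of_real k * of_real \<theta>)" for \<theta>
  proof -
    have "cis (real m * \<theta>) * cis (- (real n * \<theta>)) = cis (k * \<theta>)"
      by (simp add: cis_mult k_def left_diff_distrib)
    also have "\<dots> = exp (\<i> * of_real k * of_real \<theta>)"
      by (simp add: cis_conv_exp mult.assoc)
    finally have e: "cis (real m * \<theta>) * cis (- (real n * \<theta>)) = exp (\<i> * of_real k * of_real \<theta>)" .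
    have "(of_real r * cis \<theta>) ^ m * cnj ((of_real r * cis \<theta>) ^ n)
        = of_real r ^ (m + n) * (cis (real m * \<theta>) * cis (- (real n * \<theta>)))"
    proof -
      have pw: "(of_real r * cis \<theta>) ^ j = of_real r ^ j * cis (real j * \<theta>)" for j
        by (simp only: power_mult_distrib Complex.DeMoivre)
      have "cnj (of_real r ^ n * cis (real n * \<theta>)) = of_real r ^ n * cis (- (real n * \<theta>))"
        by (simp only: complex_cnj_mult complex_cnj_power complex_cnj_complex_of_real cis_cnj)
      then show ?thesis unfolding pw by (simp only: power_add mult_ac)
    qed
    then show ?thesis by (simp only: e)
  qed
  show ?thesis
  proof (cases "m = n")
    case True
    then have "((\<lambda>\<theta>. of_real r ^ (2 * n) :: complex) has_integral (2*pi - 0) *\<^sub>R (of_real r ^ (2 * n))) {0..2*pi}"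
      using has_integral_const_real[of "of_real r ^ (2 * n) :: complex" 0 "2*pi"] by simp
    moreover have "(\<lambda>\<theta>. (of_real r * cis \<theta>) ^ m * cnj ((of_real r * cis \<theta>) ^ n)) = (\<lambda>\<theta>. of_real r ^ (2 * n))"
      unfolding eq using True by (simp add: k_def mult_2[symmetric])
    ultimately show ?thesis
      using True by (simp only: scaleR_conv_of_real diff_zero if_True refl)
  next
    case False
    then have k0: "k \<noteq> 0" by (simp add: k_def)
    have "((\<lambda>\<theta>. exp (\<i> * of_real k * of_real \<theta>)) has_integral
        exp (\<i> * of_real k * of_real (2*pi)) / (\<i> * of_real k) - exp (\<i> * of_real k * of_real 0) / (\<i> * of_real k)) {0..2*pi}"
    proof (rule fundamental_theorem_of_calculus)
      fix x :: real
      have "((\<lambda>z. exp (\<i> * of_real k * z) / (\<i> * of_real k)) has_field_derivative exp (\<i> * of_real k * of_real x))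
          (at (of_real x))"
        using k0 by (auto intro!: derivative_eq_intros)
      then show "((\<lambda>x. exp (\<i> * of_real k * of_real x) / (\<i> * of_real k)) has_vector_derivative
          exp (\<i> * of_real k * of_real x)) (at x within {0..2*pi})"
        by (rule has_vector_derivative_real_field)
    qed simp
    moreover have "exp (\<i> * of_real k * of_real (2*pi)) = 1"
    proof -
      have "k \<in> \<int>" by (simp add: k_def)
      from exp_integer_2pi[OF this] show ?thesis by (simp add: mult_ac)
    qed
    ultimately have "((\<lambda>\<theta>. exp (\<i> * of_real k * of_real \<theta>)) has_integral 0) {0..2*pi}" by simp
    from has_integral_mult_right[OF this, of "of_real r ^ (m + n)"] False show ?thesis
      unfolding eq by simp
  qed
qed

lemma uniform_limit_circle:
  assumes a: "\<And>z. cmod z < 1 \<Longrightarrow> (\<lambda>n. a n * z ^ n) sums f z" and r: "0 \<le> r" "r < 1"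
  shows "uniform_limit UNIV (\<lambda>N \<theta>. \<Sum>n<N. a n * (of_real r * cis \<theta>) ^ n) (\<lambda>\<theta>. f (of_real r * cis \<theta>)) sequentially"
    and "bounded (range (\<lambda>\<theta>. f (of_real r * cis \<theta>)))"
proof -
  \<comment> \<open>Convergence at an intermediate radius gives absolute convergence at
    \<open>r\<close>, hence a summable majorant for the whole circle.\<close>
  obtain s where s: "r < s" "s < 1" using dense r by blast
  have "summable (\<lambda>n. a n * (of_real s) ^ n)"
    using a[of "of_real s"] s r by (auto simp: sums_iff)
  then have M: "summable (\<lambda>n. norm (a n * (of_real r) ^ n))"
    by (rule powser_insidea) (use s r in auto)
  have f: "f (of_real r * cis \<theta>) = (\<Sum>n. a n * (of_real r * cis \<theta>) ^ n)" for \<theta>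
    using a[of "of_real r * cis \<theta>"] r by (simp add: sums_iff norm_mult)
  have le: "norm (a n * (of_real r * cis \<theta>) ^ n) \<le> norm (a n * (of_real r) ^ n)" for n \<theta>
    by (simp add: norm_mult norm_power)
  show "uniform_limit UNIV (\<lambda>N \<theta>. \<Sum>n<N. a n * (of_real r * cis \<theta>) ^ n) (\<lambda>\<theta>. f (of_real r * cis \<theta>)) sequentially"
    unfolding f by (rule Weierstrass_m_test[OF _ M]) (rule le)
  have "norm (f (of_real r * cis \<theta>)) \<le> (\<Sum>n. norm (a n * (of_real r) ^ n))" for \<theta>
    unfolding f by (rule order_trans[OF summable_norm suminf_le])
      (use le M in \<open>auto intro: summable_comparison_test'[OF M, where N = 0]\<close>)
  then show "bounded (range (\<lambda>\<theta>. f (of_real r * cis \<theta>)))" by (auto intro!: boundedI)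
qed

text \<open>The products of partial sums are integrated by orthogonality of the monomials; uniform
  convergence on the circle yields integrability and the limit of the integrals at once.\<close>

lemma circle_parseval:
  assumes a: "\<And>z. cmod z < 1 \<Longrightarrow> (\<lambda>n. a n * z ^ n) sums f z"
    and b: "\<And>z. cmod z < 1 \<Longrightarrow> (\<lambda>n. b n * z ^ n) sums g z" and r: "0 \<le> r" "r < 1"
  shows "\<exists>I. ((\<lambda>\<theta>. f (of_real r * cis \<theta>) * cnj (g (of_real r * cis \<theta>)) / of_real (2*pi)) has_integral I) {0..2*pi}
    \<and> (\<lambda>n. a n * cnj (b n) * of_real r ^ (2 * n)) sums I"
proof -
  define w where "w \<theta> = of_real r * cis \<theta>" for \<theta>
  define h where "h N \<theta> = (\<Sum>n<N. a n * w \<theta> ^ n) * cnj (\<Sum>n<N. b n * w \<theta> ^ n)" for N \<theta>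
  note ua = uniform_limit_circle[OF a r] and ub = uniform_limit_circle[OF b r]
  have "uniform_limit UNIV (\<lambda>N \<theta>. cnj (\<Sum>n<N. b n * w \<theta> ^ n)) (\<lambda>\<theta>. cnj (g (w \<theta>))) sequentially"
    unfolding w_def by (rule bounded_linear.uniform_limit[OF bounded_linear_cnj ub(1)])
  moreover have "bounded (range (\<lambda>\<theta>. cnj (g (w \<theta>))))"
    using ub(2) by (simp add: w_def bounded_iff)
  ultimately have "uniform_limit UNIV h (\<lambda>\<theta>. f (w \<theta>) * cnj (g (w \<theta>))) sequentially"
    unfolding h_def using ua unfolding w_def[symmetric] by (intro uniform_lim_mult)
  then have lim: "uniform_limit {0..2*pi} h (\<lambda>\<theta>. f (w \<theta>) * cnj (g (w \<theta>))) sequentially"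
    by (rule uniform_limit_on_subset) simp
  have cont: "continuous_on {0..2*pi} (h N)" for N
    unfolding h_def w_def by (intro continuous_intros)
  obtain I J where I: "\<And>n. (h n has_integral I n) {0..2*pi}"
    "((\<lambda>\<theta>. f (w \<theta>) * cnj (g (w \<theta>))) has_integral J) {0..2*pi}" "I \<longlonglongrightarrow> J"
    using uniform_limit_integral[OF lim cont sequentially_bot] by metis
  have In: "I N = (\<Sum>n<N. of_real (2*pi) * (a n * cnj (b n) * of_real r ^ (2 * n)))" for N
  proof -
    have "h N = (\<lambda>\<theta>. \<Sum>m<N. \<Sum>n<N. (a m * cnj (b n)) * (w \<theta> ^ m * cnj (w \<theta> ^ n)))"
      by (rule ext) (simp add: h_def sum_product mult_ac)
    moreover have "((\<lambda>\<theta>. \<Sum>m<N. \<Sum>n<N. (a m * cnj (b n)) * (w \<theta> ^ m * cnj (w \<theta> ^ n))) has_integral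
       (\<Sum>m<N. \<Sum>n<N. (a m * cnj (b n)) * (if m = n then of_real (2 * pi) * of_real r ^ (2 * n) else 0))) {0..2*pi}"
      unfolding w_def
      by (intro has_integral_sum has_integral_mult_right has_integral_circle_monomials) auto
    ultimately have "(h N has_integral (\<Sum>m<N. \<Sum>n<N. (a m * cnj (b n)) * (if m = n then of_real (2 * pi) * of_real r ^ (2 * n) else 0))) {0..2*pi}"
      by (simp only:)
    then have "I N = (\<Sum>m<N. \<Sum>n<N. (a m * cnj (b n)) * (if m = n then of_real (2 * pi) * of_real r ^ (2 * n) else 0))"
      by (rule has_integral_unique[OF I(1)])
    also have "\<dots> = (\<Sum>n<N. of_real (2*pi) * (a n * cnj (b n) * of_real r ^ (2 * n)))"
      by (rule sum.cong) (auto simp: if_distrib[of "\<lambda>u. _ * u"] mult_ac cong: if_cong)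
    finally show ?thesis .
  qed
  have "(\<lambda>n. of_real (2*pi) * (a n * cnj (b n) * of_real r ^ (2 * n))) sums J"
    using I(3) unfolding sums_def In[symmetric] .
  from sums_divide[OF this, of "of_real (2*pi)"]
  have "(\<lambda>n. a n * cnj (b n) * of_real r ^ (2 * n)) sums (J / of_real (2*pi))" by simp
  moreover have "((\<lambda>\<theta>. f (w \<theta>) * cnj (g (w \<theta>)) / of_real (2*pi)) has_integral (J / of_real (2*pi))) {0..2*pi}"
    using has_integral_divide[OF I(2)] .
  ultimately show ?thesis unfolding w_def by blast
qed

lemma circle_mean_square:
  assumes a: "\<And>z. cmod z < 1 \<Longrightarrow> (\<lambda>n. a n * z ^ n) sums f z" and r: "0 \<le> r" "r < 1"
  shows "(\<lambda>n. (cmod (a n))\<^sup>2 * r ^ (2 * n)) sums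
    integral {0..2*pi} (\<lambda>\<theta>. (cmod (f (of_real r * cis \<theta>)))\<^sup>2 / (2*pi))"
proof -
  obtain I where I: "((\<lambda>\<theta>. f (of_real r * cis \<theta>) * cnj (f (of_real r * cis \<theta>)) / of_real (2*pi)) has_integral I) {0..2*pi}"
    "(\<lambda>n. a n * cnj (a n) * of_real r ^ (2 * n)) sums I"
    using circle_parseval[OF a a r] by blast
  have sq: "z * cnj z = complex_of_real ((cmod z)\<^sup>2)" for z by (rule complex_norm_square[symmetric])
  have "((\<lambda>\<theta>. Re (f (of_real r * cis \<theta>) * cnj (f (of_real r * cis \<theta>)) / of_real (2*pi))) has_integral Re I) {0..2*pi}"
    using has_integral_linear[OF I(1) bounded_linear_Re] by (simp add: o_def)
  then have "((\<lambda>\<theta>. (cmod (f (of_real r * cis \<theta>)))\<^sup>2 / (2*pi)) has_integral Re I) {0..2*pi}"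
    unfolding sq of_real_divide[symmetric] Re_complex_of_real .
  moreover have "(\<lambda>n. Re (a n * cnj (a n) * of_real r ^ (2 * n))) sums Re I"
    by (rule bounded_linear.sums[OF bounded_linear_Re I(2)])
  then have "(\<lambda>n. (cmod (a n))\<^sup>2 * r ^ (2 * n)) sums Re I"
    unfolding sq of_real_power[symmetric] of_real_mult[symmetric] Re_complex_of_real .
  ultimately show ?thesis by (simp only: integral_unique)
qed

text \<open>Absolute summability makes the series converge uniformly on the closed interval from
  \<open>0\<close> to \<open>1\<close>, so its sum is continuous up to \<open>r = 1\<close>.\<close>

lemma tendsto_suminf_at_left_1:
  fixes c :: "nat \<Rightarrow> complex"
  assumes "summable (\<lambda>n. norm (c n))"
  shows "((\<lambda>r::real. \<Sum>n. c n * of_real r ^ (2 * n)) \<longlongrightarrow> suminf c) (at_left 1)"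
proof -
  have "uniform_limit {0..1} (\<lambda>N r::real. \<Sum>n<N. c n * of_real r ^ (2 * n)) (\<lambda>r. \<Sum>n. c n * of_real r ^ (2 * n)) sequentially"
    by (rule Weierstrass_m_test[OF _ assms])
       (auto simp: norm_mult norm_power intro!: mult_right_le_one_le power_le_one)
  then have "continuous_on {0..1} (\<lambda>r::real. \<Sum>n. c n * of_real r ^ (2 * n))"
    by (rule uniform_limit_theorem[rotated]) (auto intro!: always_eventually continuous_intros)
  then have "((\<lambda>r::real. \<Sum>n. c n * of_real r ^ (2 * n)) \<longlongrightarrow> (\<Sum>n. c n * of_real 1 ^ (2 * n))) (at 1 within {0..1})"
    unfolding continuous_on_def by (rule bspec) simp
  then show ?thesis by (simp add: at_within_Icc_at_left)
qed

section \<open>Identification of square summable sequences with Hardy functions\<close>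

text \<open>The unitary map taking Taylor coefficients to the function; the value \<open>0\<close>
  off the disc matches the convention of \<open>hardy2\<close>.\<close>

definition hardy_fun :: "l2 \<Rightarrow> complex \<Rightarrow> complex" where
  "hardy_fun x z = (if cmod z < 1 then \<Sum>n. coord x n * z ^ n else 0)"

lemma hardy_fun_sums:
  assumes "cmod z < 1"
  shows "(\<lambda>n. coord x n * z ^ n) sums hardy_fun x z"
proof -
  have "summable (\<lambda>n. norm x * cmod z ^ n)"
    using assms by (intro summable_mult summable_geometric) simp
  then have "summable (\<lambda>n. coord x n * z ^ n)"
    by (rule summable_comparison_test'[where N = 0])
       (auto simp: norm_mult norm_power intro!: mult_right_mono norm_coord_le)
  with assms show ?thesis by (simp add: hardy_fun_def summable_sums)
qed

lemma hardy_fun_outside: "z \<notin> unit_disc \<Longrightarrow> hardy_fun x z = 0"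
  by (simp add: hardy_fun_def)

lemma hardy_fun_holomorphic: "hardy_fun x holomorphic_on unit_disc"
  by (rule power_series_holomorphic[of 0 1 "coord x"]) (simp add: hardy_fun_sums)

lemma hardy_fun_eqI:
  assumes "\<And>z. cmod z < 1 \<Longrightarrow> (\<lambda>n. coord x n * z ^ n) sums f z" "\<And>z. z \<notin> unit_disc \<Longrightarrow> f z = 0"
  shows "hardy_fun x = f"
proof
  fix z show "hardy_fun x z = f z"
    using assms[of z] hardy_fun_sums[of z x] by (cases "cmod z < 1") (auto simp: hardy_fun_outside intro: sums_unique2)
qed

lemma hardy_fun_add: "hardy_fun (x + y) = (\<lambda>z. hardy_fun x z + hardy_fun y z)"
  by (rule hardy_fun_eqI) (auto simp: hardy_fun_outside distrib_right intro!: sums_add hardy_fun_sums)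

lemma hardy_fun_sc: "hardy_fun (sc c x) = (\<lambda>z. c * hardy_fun x z)"
  by (rule hardy_fun_eqI) (auto simp: hardy_fun_outside mult.assoc intro!: sums_mult hardy_fun_sums)

lemma hardy_fun_sum_basis:
  "cmod z < 1 \<Longrightarrow> hardy_fun (\<Sum>k\<in>A. sc (c k) (basis_l2 k)) z = (\<Sum>k\<in>A. c k * z ^ k)"
proof (induction A rule: infinite_finite_induct)
  case (insert k A)
  have "hardy_fun (basis_l2 k) z = z ^ k"
    using hardy_fun_sums[OF \<open>cmod z < 1\<close>, of "basis_l2 k"] sums_single[of k "\<lambda>n. z ^ n"]
    by (auto simp: if_distrib[of "\<lambda>u. u * _"] cong: if_cong intro: sums_unique2)
  with insert show ?case by (simp add: hardy_fun_add hardy_fun_sc)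
qed (auto simp: hardy_fun_def)

lemma hardy_fun_basis: "cmod z < 1 \<Longrightarrow> hardy_fun (basis_l2 k) z = z ^ k"
  using hardy_fun_sum_basis[of z "\<lambda>_. 1" "{k}"] by simp

text \<open>By Parseval the circle integral is the power series of \<open>cip\<close> damped by
  \<open>r ^ (2 * n)\<close>. The convergence is recorded separately because
  \<open>cip_boundary\<close> identifies the same limit in another way.\<close>

lemma hardy2_inner_hardy_fun: "hardy2_inner (hardy_fun x) (hardy_fun y) = cip x y"
  and hardy2_inner_tendsto:
    "((\<lambda>r::real. integral {0..2*pi} (\<lambda>\<theta>. hardy_fun x (of_real r * cis \<theta>) * cnj (hardy_fun y (of_real r * cis \<theta>)) / of_real (2*pi)))
       \<longlongrightarrow> cip x y) (at_left 1)"
proof -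
  let ?I = "\<lambda>r::real. integral {0..2*pi} (\<lambda>\<theta>. hardy_fun x (of_real r * cis \<theta>) * cnj (hardy_fun y (of_real r * cis \<theta>)) / of_real (2*pi))"
  have "(\<Sum>n. coord x n * cnj (coord y n) * of_real r ^ (2 * n)) = ?I r" if r: "0 \<le> r" "r < 1" for r
  proof -
    obtain I where "((\<lambda>\<theta>. hardy_fun x (of_real r * cis \<theta>) * cnj (hardy_fun y (of_real r * cis \<theta>)) / of_real (2*pi)) has_integral I) {0..2*pi}"
      "(\<lambda>n. coord x n * cnj (coord y n) * of_real r ^ (2 * n)) sums I"
      using circle_parseval[where a = "coord x" and b = "coord y" and f = "hardy_fun x" and g = "hardy_fun y",
          OF hardy_fun_sums hardy_fun_sums r] by blast
    then show ?thesis by (simp only: integral_unique sums_iff)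
  qed
  then have "\<forall>\<^sub>F r in at_left 1. (\<Sum>n. coord x n * cnj (coord y n) * of_real r ^ (2 * n)) = ?I r"
    by (auto simp: eventually_at_left[of 0] intro!: exI[of _ 0])
  moreover have "((\<lambda>r::real. \<Sum>n. coord x n * cnj (coord y n) * of_real r ^ (2 * n)) \<longlongrightarrow> cip x y) (at_left 1)"
    unfolding cip_def by (rule tendsto_suminf_at_left_1[OF summable_norm_coord_mult_cnj])
  ultimately show lim: "(?I \<longlongrightarrow> cip x y) (at_left 1)"
    by (rule Lim_transform_eventually[rotated])
  show "hardy2_inner (hardy_fun x) (hardy_fun y) = cip x y"
    unfolding hardy2_inner_def using lim by (rule tendsto_Lim[rotated]) (rule trivial_limit_at_left_real)
qed

lemma inj_hardy_fun: "hardy_fun x = hardy_fun y \<longleftrightarrow> x = y"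
proof
  assume eq: "hardy_fun x = hardy_fun y"
  have "cip (x - y) z = 0" for z
    using hardy2_inner_hardy_fun[of x z] hardy2_inner_hardy_fun[of y z] eq by (simp add: cip_simps)
  then show "x = y" by (metis cip_self_eq_0 right_minus_eq)
qed simp

lemma mean_square_hardy_fun_le:
  assumes "0 \<le> r" "r < 1"
  shows "integral {0..2*pi} (\<lambda>\<theta>. (cmod (hardy_fun x (of_real r * cis \<theta>)))\<^sup>2 / (2*pi)) \<le> (norm x)\<^sup>2"
proof -
  note s = circle_mean_square[OF hardy_fun_sums assms, of x]
  show ?thesis
    unfolding norm_l2_power2
    by (rule sums_le[OF _ s summable_sums[OF summable_coord]])
       (use assms in \<open>auto intro!: mult_right_le_one_le power_le_one\<close>)
qed

text \<open>Parseval bounds each finite sum of \<open>(cmod (a n))\<^sup>2 * r ^ (2 * n)\<close> by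
  \<open>B\<^sup>2\<close>; letting \<open>r\<close> tend to \<open>1\<close> bounds the
  coefficients themselves.\<close>

lemma hardy_fun_from_mean_squares:
  assumes hol: "f holomorphic_on unit_disc" and out: "\<And>z. z \<notin> unit_disc \<Longrightarrow> f z = 0"
    and B: "\<And>r. 0 < r \<Longrightarrow> r < 1 \<Longrightarrow>
      integral {0..2*pi} (\<lambda>\<theta>. (cmod (f (of_real r * cis \<theta>)))\<^sup>2 / (2*pi)) \<le> B\<^sup>2" "0 \<le> B"
  shows "\<exists>x. hardy_fun x = f \<and> norm x \<le> B"
proof -
  define a where "a n = (deriv ^^ n) f 0 / fact n" for n
  have a: "(\<lambda>n. a n * z ^ n) sums f z" if "cmod z < 1" for z
    using holomorphic_power_series[OF hol, of z] that by (simp add: a_def)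
  have "(\<Sum>n<N. (cmod (a n))\<^sup>2) \<le> B\<^sup>2" for N
  proof -
    have "((\<lambda>r::real. \<Sum>n<N. (cmod (a n))\<^sup>2 * r ^ (2 * n)) \<longlongrightarrow> (\<Sum>n<N. (cmod (a n))\<^sup>2 * 1 ^ (2 * n))) (at_left 1)"
      by (intro tendsto_intros)
    moreover have "\<forall>\<^sub>F r in at_left (1::real). (\<Sum>n<N. (cmod (a n))\<^sup>2 * r ^ (2 * n)) \<le> B\<^sup>2"
    proof -
      have "(\<Sum>n<N. (cmod (a n))\<^sup>2 * r ^ (2 * n)) \<le> B\<^sup>2" if "0 < r" "r < 1" for r :: real
      proof -
        have s: "(\<lambda>n. (cmod (a n))\<^sup>2 * r ^ (2 * n)) sums
            integral {0..2*pi} (\<lambda>\<theta>. (cmod (f (of_real r * cis \<theta>)))\<^sup>2 / (2*pi))"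
          using that by (intro circle_mean_square a) auto
        have "(\<Sum>n<N. (cmod (a n))\<^sup>2 * r ^ (2 * n)) \<le> (\<Sum>n. (cmod (a n))\<^sup>2 * r ^ (2 * n))"
          by (rule sum_le_suminf[OF sums_summable[OF s]]) auto
        with B(1)[OF that] sums_unique[OF s] show ?thesis by simp
      qed
      then show ?thesis by (auto simp: eventually_at_left[of 0] intro!: exI[of _ 0])
    qed
    ultimately have "(\<Sum>n<N. (cmod (a n))\<^sup>2 * 1 ^ (2 * n)) \<le> B\<^sup>2"
      by (rule tendsto_upperbound) simp
    then show ?thesis by simp
  qed
  from l2_from_bounded_sums[OF this B(2)] obtain x where x: "coord x = a" "norm x \<le> B" by blast
  with a out have "hardy_fun x = f" by (intro hardy_fun_eqI) auto
  with x show ?thesis by blast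
qed

lemma range_hardy_fun: "range hardy_fun = hardy2"
proof (intro equalityI subsetI)
  fix f assume "f \<in> range hardy_fun"
  then obtain x where f: "f = hardy_fun x" by blast
  have "bdd_above ((\<lambda>r. integral {0..2*pi} (\<lambda>\<theta>. (cmod (f (of_real r * cis \<theta>)))\<^sup>2 / (2*pi))) ` {0<..<1})"
    unfolding f by (rule bdd_aboveI2[of _ _ "(norm x)\<^sup>2"]) (rule mean_square_hardy_fun_le; simp)
  then show "f \<in> hardy2"
    by (auto simp: hardy2_def f hardy_fun_holomorphic hardy_fun_outside)
next
  fix f assume "f \<in> hardy2"
  then have f: "f holomorphic_on unit_disc" "\<And>z. z \<notin> unit_disc \<Longrightarrow> f z = 0"
    "bdd_above ((\<lambda>r. integral {0..2*pi} (\<lambda>\<theta>. (cmod (f (of_real r * cis \<theta>)))\<^sup>2 / (2*pi))) ` {0<..<1})"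
    by (auto simp: hardy2_def)
  from f(3) obtain M where M': "\<forall>y\<in>(\<lambda>r. integral {0..2*pi} (\<lambda>\<theta>. (cmod (f (of_real r * cis \<theta>)))\<^sup>2 / (2*pi))) ` {0<..<1}. y \<le> M"
    unfolding bdd_above_def by blast
  have M: "integral {0..2*pi} (\<lambda>\<theta>. (cmod (f (of_real r * cis \<theta>)))\<^sup>2 / (2*pi)) \<le> M" if "0 < r" "r < 1" for r
    using that by (intro bspec[OF M'] imageI) simp
  \<comment> \<open>The bound \<open>M\<close> comes without a sign, hence \<open>max M 0\<close>
    under the root.\<close>
  have "\<exists>x. hardy_fun x = f \<and> norm x \<le> sqrt (max M 0)"
  proof (rule hardy_fun_from_mean_squares[OF f(1,2)])
    fix r :: real assume "0 < r" "r < 1"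
    then show "integral {0..2*pi} (\<lambda>\<theta>. (cmod (f (of_real r * cis \<theta>)))\<^sup>2 / (2*pi)) \<le> (sqrt (max M 0))\<^sup>2"
      by (simp only: real_sqrt_pow2 max.cobounded2) (rule order_trans[OF M max.cobounded1])
  qed auto
  then show "f \<in> range hardy_fun" by blast
qed

lemma hardy_fun_in_hardy2 [simp]: "hardy_fun x \<in> hardy2"
  using range_hardy_fun by blast

lemma ip_norm_hardy_fun: "ip_norm hardy2_inner (hardy_fun x) = norm x"
  by (simp add: ip_norm_def hardy2_inner_hardy_fun cip_self)

section \<open>Composition with automorphisms of the disc\<close>

text \<open>The action of the matrix with rows \<open>(p, q)\<close> and
  \<open>(cnj q, cnj p)\<close>, so that composition becomes matrix multiplication. For most
  purposes \<open>cmod q < cmod p\<close>, a positive determinant, is the only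
  normalisation.\<close>

definition mob :: "complex \<Rightarrow> complex \<Rightarrow> complex \<Rightarrow> complex" where
  "mob p q z = (p * z + q) / (cnj q * z + cnj p)"

lemma mob_denominator_nonzero:
  assumes "cmod q < cmod p" "cmod z \<le> 1"
  shows "cnj q * z + cnj p \<noteq> 0"
proof
  assume "cnj q * z + cnj p = 0"
  then have "cnj p = - (cnj q * z)" by (simp add: eq_neg_iff_add_eq_0 add.commute)
  then have "cmod p = cmod q * cmod z" by (metis complex_mod_cnj norm_minus_cancel norm_mult)
  also have "\<dots> \<le> cmod q * 1" using assms(2) by (intro mult_left_mono) auto
  finally show False using assms(1) by simp
qed

text \<open>The matrix scales the indefinite Hermitian form by its determinant; this yields
  invariance of the open disc and of the circle together.\<close>

lemma mob_norm_identity: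
  "(cmod (cnj q * z + cnj p))\<^sup>2 - (cmod (p * z + q))\<^sup>2 = ((cmod p)\<^sup>2 - (cmod q)\<^sup>2) * (1 - (cmod z)\<^sup>2)"
proof -
  have "complex_of_real ((cmod (cnj q * z + cnj p))\<^sup>2 - (cmod (p * z + q))\<^sup>2)
      = complex_of_real (((cmod p)\<^sup>2 - (cmod q)\<^sup>2) * (1 - (cmod z)\<^sup>2))"
    unfolding of_real_diff of_real_mult complex_norm_square by (simp add: algebra_simps)
  then show ?thesis by (simp only: of_real_eq_iff)
qed

lemma norm_mob_less_1:
  assumes "cmod q < cmod p" "cmod z < 1"
  shows "cmod (mob p q z) < 1"
proof -
  have "(cmod q)\<^sup>2 < (cmod p)\<^sup>2" "(cmod z)\<^sup>2 < 1"
    using assms by (auto simp: power_strict_mono abs_square_less_1)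
  then have "0 < ((cmod p)\<^sup>2 - (cmod q)\<^sup>2) * (1 - (cmod z)\<^sup>2)" by simp
  then have "(cmod (p * z + q))\<^sup>2 < (cmod (cnj q * z + cnj p))\<^sup>2"
    using mob_norm_identity[of q z p] by linarith
  then have "cmod (p * z + q) < cmod (cnj q * z + cnj p)" by (rule power_less_imp_less_base) simp
  then show ?thesis
    using mob_denominator_nonzero[of q p z] assms by (simp add: mob_def norm_divide divide_less_eq)
qed

lemma norm_mob_eq_1:
  assumes "cmod q < cmod p" "cmod z = 1"
  shows "cmod (mob p q z) = 1"
proof -
  have "(cmod (p * z + q))\<^sup>2 = (cmod (cnj q * z + cnj p))\<^sup>2"
    using mob_norm_identity[of q z p] assms(2) by simp
  then have "cmod (p * z + q) = cmod (cnj q * z + cnj p)" by (simp add: power2_eq_iff_nonneg)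
  then show ?thesis
    using mob_denominator_nonzero[of q p z] assms by (simp add: mob_def norm_divide)
qed

lemma mob_holomorphic:
  assumes "cmod q < cmod p"
  shows "mob p q holomorphic_on unit_disc"
  unfolding mob_def using mob_denominator_nonzero[OF assms]
  by (intro holomorphic_intros) (auto simp: less_imp_le)

lemma mob_continuous_on:
  assumes "cmod q < cmod p"
  shows "continuous_on (cball 0 1) (mob p q)"
  unfolding mob_def using mob_denominator_nonzero[OF assms]
  by (intro continuous_intros) auto

lemma mob_compose:
  assumes "cmod q < cmod p" "cmod s < cmod r" "cmod z < 1"
  shows "mob p q (mob r s z) = mob (p * r + q * cnj s) (p * s + q * cnj r) z"
proof -
  define d where "d = cnj s * z + cnj r"
  have d: "d \<noteq> 0" using mob_denominator_nonzero[of s r z] assms by (simp add: d_def)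
  have "mob r s z = (r * z + s) / d" by (simp add: mob_def d_def)
  then have "mob p q (mob r s z) = ((p * (r * z + s) + q * d) / d) / ((cnj q * (r * z + s) + cnj p * d) / d)"
  proof -
    have "p * (w / d) + q = (p * w + q * d) / d" "cnj q * (w / d) + cnj p = (cnj q * w + cnj p * d) / d" for w
      using d by (simp_all add: field_simps)
    then show ?thesis unfolding mob_def[of p q] \<open>mob r s z = (r * z + s) / d\<close> by simp
  qed
  also have "\<dots> = (p * (r * z + s) + q * d) / (cnj q * (r * z + s) + cnj p * d)"
    using d by simp
  also have "\<dots> = mob (p * r + q * cnj s) (p * s + q * cnj r) z"
    by (simp add: mob_def d_def algebra_simps)
  finally show ?thesis .
qed

lemma tendsto_circle_integral:
  fixes F :: "complex \<Rightarrow> complex"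
  assumes "continuous_on (cball 0 1) F"
  shows "((\<lambda>r::real. integral {0..2*pi} (\<lambda>\<theta>. F (of_real r * cis \<theta>))) \<longlongrightarrow> integral {0..2*pi} (\<lambda>\<theta>. F (cis \<theta>))) (at_left 1)"
proof -
  have "continuous_on ({0..1} \<times> cbox 0 (2*pi)) (\<lambda>(r::real, \<theta>). F (of_real r * cis \<theta>))"
    unfolding split_def
    by (rule continuous_on_compose2[OF assms]) (auto intro!: continuous_intros simp: norm_mult)
  then have "continuous_on {0..1} (\<lambda>r::real. integral (cbox 0 (2*pi)) (\<lambda>\<theta>. F (of_real r * cis \<theta>)))"
    by (rule integral_continuous_on_param)
  then have "((\<lambda>r::real. integral (cbox 0 (2*pi)) (\<lambda>\<theta>. F (of_real r * cis \<theta>))) \<longlongrightarrow>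
      integral (cbox 0 (2*pi)) (\<lambda>\<theta>. F (of_real 1 * cis \<theta>))) (at 1 within {0..1})"
    unfolding continuous_on_def by (rule bspec) simp
  then show ?thesis by (simp add: at_within_Icc_at_left)
qed

text \<open>For functions continuous up to the circle the radial limit of the means is the integral
  over the circle itself, where Moebius maps are unimodular.\<close>

lemma cip_boundary:
  assumes F: "continuous_on (cball 0 1) F" "\<And>z. cmod z < 1 \<Longrightarrow> hardy_fun x z = F z"
    and G: "continuous_on (cball 0 1) G" "\<And>z. cmod z < 1 \<Longrightarrow> hardy_fun y z = G z"
  shows "cip x y = integral {0..2*pi} (\<lambda>\<theta>. F (cis \<theta>) * cnj (G (cis \<theta>)) / of_real (2*pi))"
proof (rule tendsto_unique[OF trivial_limit_at_left_real hardy2_inner_tendsto])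
  have "((\<lambda>r::real. integral {0..2*pi} (\<lambda>\<theta>. F (of_real r * cis \<theta>) * cnj (G (of_real r * cis \<theta>)) / of_real (2*pi))) \<longlongrightarrow>
      integral {0..2*pi} (\<lambda>\<theta>. F (cis \<theta>) * cnj (G (cis \<theta>)) / of_real (2*pi))) (at_left 1)"
    by (rule tendsto_circle_integral[of "\<lambda>z. F z * cnj (G z) / of_real (2*pi)"])
       (intro continuous_intros F G; simp)
  moreover have "integral {0..2*pi} (\<lambda>\<theta>. F (of_real r * cis \<theta>) * cnj (G (of_real r * cis \<theta>)) / of_real (2*pi)) =
     integral {0..2*pi} (\<lambda>\<theta>. hardy_fun x (of_real r * cis \<theta>) * cnj (hardy_fun y (of_real r * cis \<theta>)) / of_real (2*pi))"
    if "0 \<le> r" "r < 1" for r :: real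
    using that by (simp only: F(2) G(2) norm_mult norm_of_real norm_cis abs_of_nonneg mult_1_right)
  then have "\<forall>\<^sub>F r in at_left 1. integral {0..2*pi} (\<lambda>\<theta>. F (of_real r * cis \<theta>) * cnj (G (of_real r * cis \<theta>)) / of_real (2*pi)) =
     integral {0..2*pi} (\<lambda>\<theta>. hardy_fun x (of_real r * cis \<theta>) * cnj (hardy_fun y (of_real r * cis \<theta>)) / of_real (2*pi))"
    by (auto simp only: eventually_at_left[of 0 1, OF zero_less_one] intro!: exI[of _ 0])
  ultimately show "((\<lambda>r::real. integral {0..2*pi} (\<lambda>\<theta>. hardy_fun x (of_real r * cis \<theta>) * cnj (hardy_fun y (of_real r * cis \<theta>)) / of_real (2*pi)))
     \<longlongrightarrow> integral {0..2*pi} (\<lambda>\<theta>. F (cis \<theta>) * cnj (G (cis \<theta>)) / of_real (2*pi))) (at_left 1)"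
    by (rule Lim_transform_eventually)
qed

lemma mob_power_ex:
  assumes "cmod q < cmod p"
  shows "\<exists>x. \<forall>z. cmod z < 1 \<longrightarrow> hardy_fun x z = mob p q z ^ n"
proof -
  let ?f = "\<lambda>z. if z \<in> unit_disc then mob p q z ^ n else 0"
  have "\<exists>x. hardy_fun x = ?f \<and> norm x \<le> 1"
  proof (rule hardy_fun_from_mean_squares)
    have "(\<lambda>z. mob p q z ^ n) holomorphic_on unit_disc"
      by (intro holomorphic_intros mob_holomorphic assms)
    then show "?f holomorphic_on unit_disc"
      by (rule holomorphic_transform) simp
    fix r :: real assume r: "0 < r" "r < 1"
    let ?g = "\<lambda>\<theta>. (cmod (?f (of_real r * cis \<theta>)))\<^sup>2 / (2*pi)"
    have inside: "cmod (of_real r * cis \<theta>) < 1" for \<theta> using r by (simp add: norm_mult)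
    have "continuous_on {0..2*pi} (\<lambda>\<theta>. (cmod (mob p q (of_real r * cis \<theta>) ^ n))\<^sup>2 / (2*pi))"
      by (intro continuous_intros continuous_on_compose2[OF mob_continuous_on[OF assms]])
         (use inside in \<open>auto simp: less_imp_le\<close>)
    moreover have "(cmod (mob p q (of_real r * cis \<theta>) ^ n))\<^sup>2 / (2*pi) \<le> 1 / (2*pi)" for \<theta>
      using norm_mob_less_1[OF assms inside[of \<theta>]]
      by (intro divide_right_mono) (auto simp: norm_power power_le_one)
    ultimately have "integral {0..2*pi} (\<lambda>\<theta>. (cmod (mob p q (of_real r * cis \<theta>) ^ n))\<^sup>2 / (2*pi)) \<le>
        integral {0..2*pi} (\<lambda>\<theta>. 1 / (2*pi))"
      by (intro integral_le integrable_continuous_real) (auto intro!: continuous_intros)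
    also have "\<dots> = 1" by simp
    finally show "integral {0..2*pi} ?g \<le> 1\<^sup>2"
      using inside by simp
  qed auto
  then show ?thesis by (metis mem_ball_0)
qed

section \<open>Powers of a Moebius map and their Gram matrix\<close>

definition mob_power :: "complex \<Rightarrow> complex \<Rightarrow> nat \<Rightarrow> l2" where
  "mob_power p q n = (SOME x. \<forall>z. cmod z < 1 \<longrightarrow> hardy_fun x z = mob p q z ^ n)"

lemma hardy_fun_mob_power:
  "cmod q < cmod p \<Longrightarrow> cmod z < 1 \<Longrightarrow> hardy_fun (mob_power p q n) z = mob p q z ^ n"
  using someI_ex[OF mob_power_ex, of q p n] unfolding mob_power_def by blast

lemma hardy_fun_eq_discI: "(\<And>z. cmod z < 1 \<Longrightarrow> hardy_fun x z = hardy_fun y z) \<Longrightarrow> x = y"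
  by (rule inj_hardy_fun[THEN iffD1], rule ext) (metis hardy_fun_def)

lemma mob_power_0: "cmod q < cmod p \<Longrightarrow> mob_power p q 0 = basis_l2 0"
  by (rule hardy_fun_eq_discI) (simp add: hardy_fun_mob_power hardy_fun_basis)

lemma coord_0: "coord x 0 = hardy_fun x 0"
  using hardy_fun_sums[of 0 x] powser_sums_zero[of "coord x"] sums_unique2 by fastforce

text \<open>On the circle \<open>mob p q\<close> is unimodular, so the Gram matrix of its powers is a Toeplitz matrix.\<close>

lemma cip_mob_power:
  assumes pq: "cmod q < cmod p" and "n \<le> m"
  shows "cip (mob_power p q m) (mob_power p q n) = (q / cnj p) ^ (m - n)"
proof -
  have c: "continuous_on (cball 0 1) (\<lambda>z. mob p q z ^ k)" for k
    by (intro continuous_intros mob_continuous_on pq)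
  note h = hardy_fun_mob_power[OF pq]
  have "cip (mob_power p q m) (mob_power p q n)
      = integral {0..2*pi} (\<lambda>\<theta>. mob p q (cis \<theta>) ^ m * cnj (mob p q (cis \<theta>) ^ n) / of_real (2*pi))"
    by (intro cip_boundary c h)
  also have "\<dots> = integral {0..2*pi} (\<lambda>\<theta>. mob p q (cis \<theta>) ^ (m - n) * cnj (mob p q (cis \<theta>) ^ 0) / of_real (2*pi))"
  proof -
    have "z ^ m * cnj (z ^ n) = z ^ (m - n) * cnj (z ^ 0)" if "cmod z = 1" for z
    proof -
      have "z ^ n * cnj (z ^ n) = 1"
        using that by (simp add: complex_norm_square[symmetric] norm_power del: complex_cnj_power)
      moreover have "z ^ m = z ^ (m - n) * z ^ n" using \<open>n \<le> m\<close> by (simp add: power_add[symmetric])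
      ultimately show ?thesis by (simp add: mult.assoc)
    qed
    then show ?thesis using norm_mob_eq_1[OF pq norm_cis] by simp
  qed
  \<comment> \<open>Read backwards, the integral pairs a single power with the constant function
    \<open>1\<close>, which evaluates that power at \<open>0\<close>.\<close>
  also have "\<dots> = cip (mob_power p q (m - n)) (mob_power p q 0)"
    by (intro cip_boundary[symmetric] c h)
  also have "\<dots> = hardy_fun (mob_power p q (m - n)) 0"
    by (simp add: mob_power_0[OF pq] cip_basis_right coord_0)
  also have "\<dots> = (q / cnj p) ^ (m - n)"
    by (simp add: h mob_def)
  finally show ?thesis .
qed

text \<open>With truncated subtraction on the naturals, \<open>(m - n) + (n - m)\<close> is the
  distance of \<open>m\<close> and \<open>n\<close>.\<close>

lemma norm_cip_mob_power:
  assumes pq: "cmod q < cmod p"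
  shows "cmod (cip (mob_power p q m) (mob_power p q n)) = (cmod q / cmod p) ^ ((m - n) + (n - m))"
proof (cases "n \<le> m")
  case True
  then show ?thesis by (simp add: cip_mob_power[OF pq] norm_power norm_divide)
next
  case False
  then have "cip (mob_power p q m) (mob_power p q n) = cnj ((q / cnj p) ^ (n - m))"
    by (metis cip_mob_power[OF pq] cnj_cip nat_le_linear)
  with False show ?thesis by (simp add: norm_power norm_divide)
qed

text \<open>The row bound for the Schur test below: the indices up to \<open>m\<close> and those
  beyond \<open>m\<close> each contribute at most a geometric series.\<close>

lemma sum_power_dist_le:
  fixes \<rho> :: real
  assumes "0 \<le> \<rho>" "\<rho> < 1" "finite A"
  shows "(\<Sum>n\<in>A. \<rho> ^ ((m - n) + (n - m))) \<le> 2 / (1 - \<rho>)"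
proof -
  have geo: "(\<Sum>k\<in>B. \<rho> ^ k) \<le> 1 / (1 - \<rho>)" if "finite B" for B
    using sum_le_suminf[OF summable_geometric, of \<rho> B] suminf_geometric[of \<rho>] assms that by simp
  have "(\<Sum>n\<in>A. \<rho> ^ ((m - n) + (n - m))) = (\<Sum>n\<in>A \<inter> {..m}. \<rho> ^ (m - n)) + (\<Sum>n\<in>A - {..m}. \<rho> ^ (n - m))"
    using sum.Int_Diff[OF \<open>finite A\<close>, of "\<lambda>n. \<rho> ^ ((m - n) + (n - m))" "{..m}"] by simp
  also have "(\<Sum>n\<in>A \<inter> {..m}. \<rho> ^ (m - n)) = (\<Sum>k\<in>(\<lambda>n. m - n) ` (A \<inter> {..m}). \<rho> ^ k)"
    by (subst sum.reindex) (auto simp: inj_on_def)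
  also have "\<dots> \<le> 1 / (1 - \<rho>)" by (rule geo) (use assms in auto)
  also have "(\<Sum>n\<in>A - {..m}. \<rho> ^ (n - m)) = (\<Sum>k\<in>(\<lambda>n. n - m) ` (A - {..m}). \<rho> ^ k)"
    by (subst sum.reindex) (auto simp: inj_on_def)
  also have "\<dots> \<le> 1 / (1 - \<rho>)" by (rule geo) (use assms in auto)
  finally show ?thesis by simp
qed

lemma cip_sum_left: "cip (\<Sum>k\<in>A. f k) y = (\<Sum>k\<in>A. cip (f k) y)"
  by (induction A rule: infinite_finite_induct) (auto simp: cip_simps)

lemma cip_sum_right: "cip y (\<Sum>k\<in>A. f k) = (\<Sum>k\<in>A. cip y (f k))"
  by (induction A rule: infinite_finite_induct) (auto simp: cip_simps)

text \<open>Schur test for the Gram matrix: the product of two coefficients is replaced by the mean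
  of their squares, and symmetry reduces the double sum to row sums. Arbitrary finite
  \<open>A\<close> are allowed so that the bound applies to tails of series too.\<close>

lemma norm_sum_mob_power_le:
  assumes pq: "cmod q < cmod p" and A: "finite A"
  shows "(norm (\<Sum>k\<in>A. sc (c k) (mob_power p q k)))\<^sup>2 \<le> 2 / (1 - cmod q / cmod p) * (\<Sum>k\<in>A. (cmod (c k))\<^sup>2)"
proof -
  define \<rho> where "\<rho> = cmod q / cmod p"
  have \<rho>: "0 \<le> \<rho>" "\<rho> < 1"
    using pq le_less_trans[OF norm_ge_zero pq] by (auto simp: \<rho>_def)
  define d where "d m n = \<rho> ^ ((m - n) + (n - m))" for m n :: nat
  have d0: "0 \<le> d m n" and dsym: "d m n = d n m" for m n using \<rho> by (auto simp: d_def add.commute)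
  define x where "x = (\<Sum>k\<in>A. sc (c k) (mob_power p q k))"
  have "cip x x = (\<Sum>m\<in>A. \<Sum>n\<in>A. c m * cnj (c n) * cip (mob_power p q m) (mob_power p q n))"
    by (simp add: x_def cip_sum_left cip_sum_right cip_simps mult.assoc sum_distrib_left)
       (subst sum.swap, simp add: mult.left_commute)
  then have "(norm x)\<^sup>2 = cmod (\<Sum>m\<in>A. \<Sum>n\<in>A. c m * cnj (c n) * cip (mob_power p q m) (mob_power p q n))"
    by (metis cip_self norm_of_real abs_of_nonneg zero_le_power2)
  also have "\<dots> \<le> (\<Sum>m\<in>A. \<Sum>n\<in>A. cmod (c m * cnj (c n) * cip (mob_power p q m) (mob_power p q n)))"
    by (intro sum_norm_le order_refl)
  also have "\<dots> = (\<Sum>m\<in>A. \<Sum>n\<in>A. cmod (c m) * cmod (c n) * d m n)"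
    by (simp add: norm_mult norm_cip_mob_power[OF pq] d_def \<rho>_def)
  also have "\<dots> \<le> (\<Sum>m\<in>A. \<Sum>n\<in>A. ((cmod (c m))\<^sup>2 + (cmod (c n))\<^sup>2) / 2 * d m n)"
  proof -
    have sq: "a * b \<le> (a\<^sup>2 + b\<^sup>2) / 2" for a b :: real
      using sum_squares_bound[of a b] by (simp add: field_simps)
    show ?thesis by (intro sum_mono mult_right_mono d0 sq)
  qed
  also have "\<dots> = ((\<Sum>m\<in>A. \<Sum>n\<in>A. (cmod (c m))\<^sup>2 * d m n) + (\<Sum>m\<in>A. \<Sum>n\<in>A. (cmod (c n))\<^sup>2 * d m n)) / 2"
    by (simp add: sum.distrib[symmetric] sum_divide_distrib algebra_simps add_divide_distrib)
  also have "(\<Sum>m\<in>A. \<Sum>n\<in>A. (cmod (c n))\<^sup>2 * d m n) = (\<Sum>m\<in>A. \<Sum>n\<in>A. (cmod (c m))\<^sup>2 * d m n)"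
    by (subst sum.swap) (simp add: dsym)
  also have "((\<Sum>m\<in>A. \<Sum>n\<in>A. (cmod (c m))\<^sup>2 * d m n) + (\<Sum>m\<in>A. \<Sum>n\<in>A. (cmod (c m))\<^sup>2 * d m n)) / 2
      = (\<Sum>m\<in>A. (cmod (c m))\<^sup>2 * (\<Sum>n\<in>A. d m n))"
  proof -
    have half: "(a + a) / 2 = a" for a :: real by simp
    show ?thesis unfolding sum_distrib_left by (rule half)
  qed
  also have "\<dots> \<le> (\<Sum>m\<in>A. (cmod (c m))\<^sup>2 * (2 / (1 - \<rho>)))"
    unfolding d_def by (intro sum_mono mult_left_mono sum_power_dist_le \<rho> A) simp
  also have "\<dots> = 2 / (1 - \<rho>) * (\<Sum>k\<in>A. (cmod (c k))\<^sup>2)"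
    by (simp add: sum_distrib_left mult.commute)
  finally show ?thesis by (simp add: x_def \<rho>_def)
qed

section \<open>The composition operator on sequences\<close>

text \<open>Expansion in the images of the monomials; \<open>summable_comp_l2\<close> gives
  convergence and \<open>hardy_fun_comp_l2\<close> identifies the sum as composition with
  \<open>mob p q\<close>.\<close>

definition comp_l2 :: "complex \<Rightarrow> complex \<Rightarrow> l2 \<Rightarrow> l2" where
  "comp_l2 p q x = (\<Sum>k. sc (coord x k) (mob_power p q k))"

lemma summable_comp_l2:
  assumes pq: "cmod q < cmod p"
  shows "summable (\<lambda>k. sc (coord x k) (mob_power p q k))"
  unfolding summable_Cauchy
proof (intro allI impI)
  fix e :: real assume e: "e > 0"
  define K where "K = 2 / (1 - cmod q / cmod p)"
  have "cmod q / cmod p < 1" using pq le_less_trans[OF norm_ge_zero pq] by simp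
  then have K: "K > 0" by (simp add: K_def)
  have "e\<^sup>2 / K > 0" using e K by simp
  then obtain N where N: "\<And>m n. m \<ge> N \<Longrightarrow> norm (\<Sum>k=m..<n. (cmod (coord x k))\<^sup>2) < e\<^sup>2 / K"
    using summable_coord[of x] unfolding summable_Cauchy by blast
  have "norm (\<Sum>k=m..<n. sc (coord x k) (mob_power p q k)) < e" if "m \<ge> N" for m n
  proof -
    have "(norm (\<Sum>k=m..<n. sc (coord x k) (mob_power p q k)))\<^sup>2 \<le> K * (\<Sum>k=m..<n. (cmod (coord x k))\<^sup>2)"
      unfolding K_def by (rule norm_sum_mob_power_le[OF pq]) simp
    also have "\<dots> < K * (e\<^sup>2 / K)"
      using N[OF that, of n] K by (intro mult_strict_left_mono) auto
    also have "\<dots> = e\<^sup>2" using K by simp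
    finally show ?thesis using e by (auto intro: power_less_imp_less_base)
  qed
  then show "\<exists>N. \<forall>m\<ge>N. \<forall>n. norm (\<Sum>k=m..<n. sc (coord x k) (mob_power p q k)) < e" by blast
qed

text \<open>Evaluation at \<open>z\<close> is the inner product with the Szegoe kernel
  \<open>k\<close>, whose coefficients are the powers of \<open>cnj z\<close>.\<close>

lemma bounded_linear_hardy_fun:
  assumes "cmod z < 1"
  shows "bounded_linear (\<lambda>x. hardy_fun x z)"
proof -
  have "summable (\<lambda>n. (cmod (cnj z ^ n))\<^sup>2)"
    using assms by (simp add: norm_power power_mult[symmetric] power_mult[of _ 2, symmetric] mult.commute[of _ 2])
      (simp add: power_mult abs_square_less_1)
  then obtain k where k: "coord k = (\<lambda>n. cnj z ^ n)" using coord_Abs by metis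
  have "hardy_fun x z = cip x k" for x
    using hardy_fun_sums[OF assms, of x] by (simp add: cip_def k sums_iff)
  then show ?thesis using bounded_linear_cip_left by simp
qed

lemma hardy_fun_comp_l2:
  assumes pq: "cmod q < cmod p" and z: "cmod z < 1"
  shows "hardy_fun (comp_l2 p q x) z = hardy_fun x (mob p q z)"
proof -
  have "hardy_fun (comp_l2 p q x) z = (\<Sum>k. hardy_fun (sc (coord x k) (mob_power p q k)) z)"
    unfolding comp_l2_def by (rule bounded_linear.suminf[OF bounded_linear_hardy_fun[OF z] summable_comp_l2[OF pq]])
  also have "\<dots> = (\<Sum>k. coord x k * mob p q z ^ k)"
    by (simp add: hardy_fun_sc hardy_fun_mob_power[OF pq z])
  also have "\<dots> = hardy_fun x (mob p q z)"
    using norm_mob_less_1[OF pq z] by (simp add: hardy_fun_def)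
  finally show ?thesis .
qed

lemma comp_l2_add: "cmod q < cmod p \<Longrightarrow> comp_l2 p q (x + y) = comp_l2 p q x + comp_l2 p q y"
  by (rule hardy_fun_eq_discI) (simp add: hardy_fun_comp_l2 hardy_fun_add)

lemma comp_l2_sc: "cmod q < cmod p \<Longrightarrow> comp_l2 p q (sc c x) = sc c (comp_l2 p q x)"
  by (rule hardy_fun_eq_discI) (simp add: hardy_fun_comp_l2 hardy_fun_sc)

lemma bounded_linear_comp_l2:
  assumes pq: "cmod q < cmod p"
  shows "bounded_linear (comp_l2 p q)"
proof (rule bounded_linear_intro[where K = "sqrt (2 / (1 - cmod q / cmod p))"])
  define K where "K = 2 / (1 - cmod q / cmod p)"
  have "cmod q / cmod p < 1" using pq le_less_trans[OF norm_ge_zero pq] by simp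
  then have K: "K > 0" by (simp add: K_def)
  fix x
  have "(\<lambda>N. norm (\<Sum>k<N. sc (coord x k) (mob_power p q k))) \<longlonglongrightarrow> norm (comp_l2 p q x)"
    unfolding comp_l2_def by (intro tendsto_norm summable_LIMSEQ summable_comp_l2 pq)
  moreover have "norm (\<Sum>k<N. sc (coord x k) (mob_power p q k)) \<le> norm x * sqrt K" for N
  proof -
    have "(norm (\<Sum>k<N. sc (coord x k) (mob_power p q k)))\<^sup>2 \<le> K * (\<Sum>k<N. (cmod (coord x k))\<^sup>2)"
      unfolding K_def by (rule norm_sum_mob_power_le[OF pq]) simp
    also have "\<dots> \<le> K * (norm x)\<^sup>2" using K by (intro mult_left_mono sum_coord_le) simp
    also have "\<dots> = (norm x * sqrt K)\<^sup>2" using K by (simp add: power_mult_distrib)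
    finally show ?thesis by (rule power2_le_imp_le) (use K in simp)
  qed
  ultimately show "norm (comp_l2 p q x) \<le> norm x * sqrt (2 / (1 - cmod q / cmod p))"
    unfolding K_def[symmetric] by (intro LIMSEQ_le_const2) auto
qed (simp_all add: comp_l2_add comp_l2_sc pq scaleR_sc)

section \<open>Transfer of complex symmetry to sequences\<close>

definition conjugation_l2 :: "(l2 \<Rightarrow> l2) \<Rightarrow> bool" where
  "conjugation_l2 C \<longleftrightarrow> (\<forall>x y. C (x + y) = C x + C y) \<and> (\<forall>c x. C (sc c x) = sc (cnj c) (C x)) \<and>
     (\<forall>x. norm (C x) = norm x) \<and> (\<forall>x. C (C x) = x)"

lemma composition_operator_hardy_fun:
  assumes pq: "cmod q < cmod p" and \<phi>: "\<And>z. cmod z < 1 \<Longrightarrow> \<phi> z = mob p q z"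
  shows "composition_operator \<phi> (hardy_fun x) = hardy_fun (comp_l2 p q x)"
  by (rule ext) (auto simp: composition_operator_def \<phi> hardy_fun_comp_l2[OF pq] hardy_fun_outside)

text \<open>Maps of \<open>hardy2\<close> and maps of \<open>l2\<close> correspond along the
  bijection \<open>hardy_fun\<close>. From right to left, the boundedness clause is supplied by
  \<open>bounded_linear_comp_l2\<close>.\<close>

lemma complex_symmetric_iff_l2:
  assumes pq: "cmod q < cmod p" and \<phi>: "\<And>z. cmod z < 1 \<Longrightarrow> \<phi> z = mob p q z"
  shows "complex_symmetric_on hardy2 hardy2_inner (composition_operator \<phi>) \<longleftrightarrow>
    (\<exists>C S. conjugation_l2 C \<and> (\<forall>x y. cip (comp_l2 p q x) y = cip x (S y)) \<and>
       (\<forall>x. comp_l2 p q x = C (S (C x))))" (is "?L \<longleftrightarrow> ?R")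
proof
  note T = composition_operator_hardy_fun[OF pq \<phi>]
  have inv: "\<exists>F'. \<forall>x. F (hardy_fun x) = hardy_fun (F' x)" if "\<forall>f\<in>hardy2. F f \<in> hardy2" for F
  proof -
    have "\<exists>y. F (hardy_fun x) = hardy_fun y" for x
      using that hardy_fun_in_hardy2[of x] unfolding range_hardy_fun[symmetric] by blast
    then show ?thesis by metis
  qed
  assume ?L
  then obtain C S where C: "conjugation_on hardy2 hardy2_inner C"
    and S: "is_adjoint_on hardy2 hardy2_inner (composition_operator \<phi>) S"
    and TCS: "\<And>f. f \<in> hardy2 \<Longrightarrow> composition_operator \<phi> f = C (S (C f))"
    unfolding complex_symmetric_on_def by blast
  obtain C' S' where C': "\<And>x. C (hardy_fun x) = hardy_fun (C' x)" and S': "\<And>x. S (hardy_fun x) = hardy_fun (S' x)"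
    using inv[of C] inv[of S] C S unfolding conjugation_on_def is_adjoint_on_def by metis
  have "conjugation_l2 C'"
    unfolding conjugation_l2_def
  proof (intro conjI allI)
    fix x y c
    have "C (\<lambda>z. hardy_fun x z + hardy_fun y z) = (\<lambda>z. C (hardy_fun x) z + C (hardy_fun y) z)"
      using C by (simp add: conjugation_on_def)
    then show "C' (x + y) = C' x + C' y"
      by (simp add: C' hardy_fun_add[symmetric] inj_hardy_fun)
    have "C (\<lambda>z. c * hardy_fun x z) = (\<lambda>z. cnj c * C (hardy_fun x) z)"
      using C by (simp add: conjugation_on_def)
    then show "C' (sc c x) = sc (cnj c) (C' x)"
      by (simp add: C' hardy_fun_sc[symmetric] inj_hardy_fun)
    have "ip_norm hardy2_inner (C (hardy_fun x)) = ip_norm hardy2_inner (hardy_fun x)"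
      using C by (simp add: conjugation_on_def)
    then show "norm (C' x) = norm x" by (simp add: C' ip_norm_hardy_fun)
    have "C (C (hardy_fun x)) = hardy_fun x"
      using C by (simp add: conjugation_on_def)
    then show "C' (C' x) = x" by (simp add: C' inj_hardy_fun)
  qed
  moreover have "cip (comp_l2 p q x) y = cip x (S' y)" for x y
  proof -
    have "hardy2_inner (composition_operator \<phi> (hardy_fun x)) (hardy_fun y) = hardy2_inner (hardy_fun x) (S (hardy_fun y))"
      using S by (simp add: is_adjoint_on_def)
    then show ?thesis by (simp add: T S' hardy2_inner_hardy_fun)
  qed
  moreover have "comp_l2 p q x = C' (S' (C' x))" for x
    using TCS[of "hardy_fun x"] by (simp add: T C' S' inj_hardy_fun)
  ultimately show ?R by blast
next
  note T = composition_operator_hardy_fun[OF pq \<phi>]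
  assume ?R
  then obtain C S where C: "conjugation_l2 C" and S: "\<And>x y. cip (comp_l2 p q x) y = cip x (S y)"
    and TCS: "\<And>x. comp_l2 p q x = C (S (C x))" by blast
  define lft where "lft F f = hardy_fun (F (inv hardy_fun f))" for F :: "l2 \<Rightarrow> l2" and f
  have inv: "inv hardy_fun (hardy_fun x) = x" for x
    by (rule inv_f_f) (simp add: inj_def inj_hardy_fun)
  have lft: "lft F (hardy_fun x) = hardy_fun (F x)" for F x by (simp add: lft_def inv)
  have ball: "(\<forall>f\<in>hardy2. P f) \<longleftrightarrow> (\<forall>x. P (hardy_fun x))" for P
    unfolding range_hardy_fun[symmetric] by blast
  interpret T: bounded_linear "comp_l2 p q" by (rule bounded_linear_comp_l2[OF pq])
  have "conjugation_on hardy2 hardy2_inner (lft C)"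
    using C unfolding conjugation_on_def ball conjugation_l2_def
    by (simp add: lft hardy_fun_add[symmetric] hardy_fun_sc[symmetric] ip_norm_hardy_fun)
  moreover have "is_adjoint_on hardy2 hardy2_inner (composition_operator \<phi>) (lft S)"
    unfolding is_adjoint_on_def ball by (simp add: T lft hardy2_inner_hardy_fun S)
  moreover have "\<forall>f\<in>hardy2. composition_operator \<phi> f = lft C (lft S (lft C f))"
    unfolding ball by (simp add: T lft TCS)
  moreover have "bounded_operator_on hardy2 hardy2_inner (composition_operator \<phi>)"
  proof -
    obtain K where "\<And>x. norm (comp_l2 p q x) \<le> norm x * K" using T.bounded by blast
    then have "\<exists>B. \<forall>x. norm (comp_l2 p q x) \<le> B * norm x" by (metis mult.commute)
    then show ?thesis
      unfolding bounded_operator_on_def ball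
      by (simp add: T hardy_fun_add[symmetric] hardy_fun_sc[symmetric] ip_norm_hardy_fun comp_l2_add comp_l2_sc pq)
  qed
  ultimately show ?L unfolding complex_symmetric_on_def by blast
qed

text \<open>Precomposing with a Moebius map that takes \<open>0\<close> to the zero \<open>b\<close>
  of \<phi> leaves an automorphism fixing \<open>0\<close>, which is a rotation by the Schwarz
  lemma.\<close>

lemma disc_automorphism_mob:
  assumes "disc_automorphism \<phi>"
  obtains p q where "(cmod p)\<^sup>2 - (cmod q)\<^sup>2 = 1" "\<And>z. cmod z < 1 \<Longrightarrow> \<phi> z = mob p q z"
proof -
  obtain \<psi> where hol: "\<phi> holomorphic_on unit_disc" "\<psi> holomorphic_on unit_disc"
    and into: "\<And>z. cmod z < 1 \<Longrightarrow> cmod (\<phi> z) < 1" "\<And>z. cmod z < 1 \<Longrightarrow> cmod (\<psi> z) < 1"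
    and inv: "\<And>z. cmod z < 1 \<Longrightarrow> \<psi> (\<phi> z) = z" "\<And>z. cmod z < 1 \<Longrightarrow> \<phi> (\<psi> z) = z"
    using assms unfolding disc_automorphism_def image_subset_iff by auto
  define b where "b = \<psi> 0"
  have b: "cmod b < 1" "\<phi> b = 0" by (simp_all add: b_def into inv)
  have b1: "cmod b < cmod 1" "cmod (- b) < cmod 1" using b by auto
  have bb: "1 - b * cnj b \<noteq> 0"
    using b(1) by (metis complex_norm_square eq_iff_diff_eq_0 norm_mult_less norm_of_real norm_one
        abs_power2 power2_eq_square norm_power less_irrefl mult_1 norm_mult)
  have cb: "cnj (1 - b * cnj b) = 1 - b * cnj b" by (simp add: mult.commute)
  have M: "mob 1 b (mob 1 (- b) z) = z" "mob 1 (- b) (mob 1 b z) = z" if "cmod z < 1" for z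
    using bb cb that by (simp_all add: mob_compose[OF b1 that] mob_compose[OF b1(2,1) that])
      (simp_all add: mob_def mult.commute[of "cnj b"])
  define h where "h = \<phi> \<circ> mob 1 b"
  define k where "k = mob 1 (- b) \<circ> \<psi>"
  have h_lt: "cmod (h z) < 1" if "cmod z < 1" for z
    using that by (simp add: h_def into norm_mob_less_1[OF b1(1)])
  have k_lt: "cmod (k z) < 1" if "cmod z < 1" for z
    using that by (simp add: k_def into norm_mob_less_1[OF b1(2)])
  have "h holomorphic_on unit_disc" unfolding h_def
    by (rule holomorphic_on_compose_gen[OF mob_holomorphic[OF b1(1)] hol(1)])
       (auto simp: norm_mob_less_1[OF b1(1)])
  moreover have "k holomorphic_on unit_disc" unfolding k_def
    by (rule holomorphic_on_compose_gen[OF hol(2) mob_holomorphic[OF b1(2)]])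
       (auto simp: into)
  moreover have h0: "h 0 = 0" "k 0 = 0" by (simp_all add: h_def k_def mob_def b b_def[symmetric])
  ultimately have le: "cmod (h z) \<le> cmod z" "cmod (k z) \<le> cmod z" if "cmod z < 1" for z
    using Schwarz_Lemma(1)[of h] Schwarz_Lemma(1)[of k] that h_lt k_lt by auto
  have kh: "k (h z) = z" if "cmod z < 1" for z
    using that by (simp add: h_def k_def inv norm_mob_less_1[OF b1(1)] M)
  \<comment> \<open>Any nonzero point would serve: the Schwarz bounds for \<open>h\<close> and for
    its left inverse \<open>k\<close> give equality there, the rigid case of the lemma.\<close>
  have "cmod (h (1/2)) = cmod (1/2)"
    using le(1)[of "1/2"] le(2)[of "h (1/2)"] kh[of "1/2"] h_lt[of "1/2"] by simp
  then have "\<exists>z. cmod z < 1 \<and> z \<noteq> 0 \<and> cmod (h z) = cmod z"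
    by (intro exI[of _ "1/2"]) auto
  then obtain \<alpha> where \<alpha>: "\<And>z. cmod z < 1 \<Longrightarrow> h z = \<alpha> * z" "cmod \<alpha> = 1"
    using Schwarz_Lemma(3)[OF \<open>h holomorphic_on unit_disc\<close> h0(1) h_lt, of 0] by auto
  \<comment> \<open>Since \<open>cmod u = 1\<close>, one has \<alpha> \<open>= u / cnj u\<close>, so
    a square root of \<alpha> puts the rotation into the form of \<open>mob\<close>. Dividing by
    \<open>s\<close> below makes the determinant \<open>1\<close>.\<close>
  define u where "u = csqrt \<alpha>"
  have u2: "u * u = \<alpha>" by (simp add: u_def power2_eq_square[symmetric])
  have u1: "cmod u = 1" using \<alpha>(2) u2 by (metis abs_norm_cancel norm_mult power2_eq_1_iff power2_eq_square abs_1 abs_minus_cancel)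
  then have uc: "u * cnj u = 1" by (simp add: complex_norm_square[symmetric])
  have u0: "u \<noteq> 0" "cnj u \<noteq> 0" using u1 by auto
  define s where "s = sqrt (1 - (cmod b)\<^sup>2)"
  have "(cmod b)\<^sup>2 < 1" using b(1) by (simp add: abs_square_less_1)
  then have s: "s > 0" "s\<^sup>2 = 1 - (cmod b)\<^sup>2" by (simp_all add: s_def)
  show ?thesis
  proof (rule that[of "u / of_real s" "- u * b / of_real s"])
    show "(cmod (u / of_real s))\<^sup>2 - (cmod (- u * b / of_real s))\<^sup>2 = 1"
      using s \<open>(cmod b)\<^sup>2 < 1\<close>
      by (simp add: norm_mult norm_divide u1 power_divide diff_divide_distrib[symmetric])
    fix z assume z: "cmod z < 1"
    have "\<phi> z = h (mob 1 (- b) z)"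
      using z by (simp add: h_def M)
    also have "\<dots> = \<alpha> * mob 1 (- b) z"
      by (rule \<alpha>) (rule norm_mob_less_1[OF b1(2) z])
    also have "\<dots> = mob (u / of_real s) (- u * b / of_real s) z"
    proof -
      have d: "1 - cnj b * z \<noteq> 0"
        using mob_denominator_nonzero[OF b1(2), of z] z by simp
      have "mob (u / of_real s) (- u * b / of_real s) z = ((u * (z - b)) / of_real s) / ((cnj u * (1 - cnj b * z)) / of_real s)"
        by (simp add: mob_def algebra_simps diff_divide_distrib)
      also have "\<dots> = (u * (z - b)) / (cnj u * (1 - cnj b * z))" using s by simp
      also have "\<dots> = (u / cnj u) * ((z - b) / (1 - cnj b * z))" by simp
      also have "u / cnj u = \<alpha>"
      proof -
        have "u = \<alpha> * cnj u" unfolding u2[symmetric] using uc by (simp add: mult.assoc)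
        then show ?thesis using u0 by (simp add: field_simps)
      qed
      also have "(z - b) / (1 - cnj b * z) = mob 1 (- b) z" by (simp add: mob_def)
      finally show ?thesis by simp
    qed
    finally show "\<phi> z = mob (u / of_real s) (- u * b / of_real s) z" .
  qed
qed

section \<open>The complex symmetric cases\<close>

text \<open>For \<open>\<bar>\<omega>\<bar> = 1\<close> this is \<open>f \<mapsto> (\<lambda>z. cnj (f (\<omega> * cnj z)))\<close>; otherwise it is junk.\<close>

lift_definition conj_l2 :: "complex \<Rightarrow> l2 \<Rightarrow> l2" is
  "\<lambda>\<omega> x n. if cmod \<omega> = 1 then cnj (\<omega> ^ n * x n) else 0"
  subgoal for \<omega> x by (cases "cmod \<omega> = 1") (simp_all add: norm_mult norm_power)
  done

lemma coord_conj_l2: "cmod \<omega> = 1 \<Longrightarrow> coord (conj_l2 \<omega> x) n = cnj (\<omega> ^ n * coord x n)"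
  by (simp add: conj_l2.rep_eq)

lemma norm_conj_l2: "cmod \<omega> = 1 \<Longrightarrow> norm (conj_l2 \<omega> x) = norm x"
proof -
  assume "cmod \<omega> = 1"
  then have "(norm (conj_l2 \<omega> x))\<^sup>2 = (norm x)\<^sup>2"
    unfolding norm_l2_power2 by (simp add: coord_conj_l2 norm_mult norm_power)
  then show ?thesis by (simp add: power2_eq_iff_nonneg)
qed

lemma conjugation_conj_l2: "cmod \<omega> = 1 \<Longrightarrow> conjugation_l2 (conj_l2 \<omega>)"
proof -
  assume \<omega>: "cmod \<omega> = 1"
  then have "cnj \<omega> * \<omega> = 1" by (metis complex_norm_square mult.commute of_real_1 power_one)
  then have "cnj \<omega> ^ n * \<omega> ^ n = 1" for n by (metis power_mult_distrib power_one)
  then have "cnj \<omega> ^ n * (\<omega> ^ n * c) = c" for n c by (metis mult.assoc mult_1)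
  then show ?thesis
    by (auto simp: conjugation_l2_def coord_conj_l2 norm_conj_l2 \<omega> algebra_simps intro!: l2_eqI)
qed

lemma hardy_fun_conj_l2:
  assumes \<omega>: "cmod \<omega> = 1" and z: "cmod z < 1"
  shows "hardy_fun (conj_l2 \<omega> x) z = cnj (hardy_fun x (\<omega> * cnj z))"
proof -
  have "cmod (\<omega> * cnj z) < 1" using \<omega> z by (simp add: norm_mult)
  from bounded_linear.sums[OF bounded_linear_cnj hardy_fun_sums[OF this, of x]]
  have "(\<lambda>n. coord (conj_l2 \<omega> x) n * z ^ n) sums cnj (hardy_fun x (\<omega> * cnj z))"
    by (simp add: coord_conj_l2 \<omega> power_mult_distrib mult_ac)
  then show ?thesis by (rule sums_unique2[OF hardy_fun_sums[OF z]])
qed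

text \<open>Polarisation of the norm gives the real part; applying it to \<open>sc \<i> y\<close>,
  where \<open>C\<close> conjugates the scalar, gives the imaginary part.\<close>

lemma conjugation_cip:
  assumes C: "conjugation_l2 C"
  shows "cip (C x) (C y) = cip y x"
proof -
  have add: "C (x + y) = C x + C y" and sc: "C (sc c x) = sc (cnj c) (C x)" and nrm: "norm (C x) = norm x" for x y c
    using C by (auto simp: conjugation_l2_def)
  have inner: "inner (C x) (C y) = inner x y" for x y
  proof -
    have n: "(norm (x + y))\<^sup>2 = (norm x)\<^sup>2 + 2 * inner x y + (norm y)\<^sup>2" for x y :: l2
      by (simp add: power2_norm_eq_inner inner_add_left inner_add_right inner_commute)
    have "(norm (C x + C y))\<^sup>2 = (norm (x + y))\<^sup>2" by (simp add: add[symmetric] nrm)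
    then show ?thesis unfolding n by (simp add: nrm)
  qed
  have "inner (C x) (sc \<i> (C y)) = - inner x (sc \<i> y)"
  proof -
    have "inner (C x) (sc (cnj \<i>) (C y)) = inner x (sc \<i> y)"
      by (simp only: sc[symmetric] inner)
    moreover have "sc (cnj \<i>) (C y) = - sc \<i> (C y)" by (rule l2_eqI) simp
    ultimately show ?thesis by simp
  qed
  then have "cip (C x) (C y) = cnj (cip x y)"
    by (simp add: complex_eq_iff Re_cip Im_cip inner)
  then show ?thesis by (simp add: cnj_cip)
qed

section \<open>Conjugations for rotations and for involutions\<close>

lemma complex_symmetric_rotation:
  assumes pq: "cmod q < cmod p" and rot: "\<And>z. cmod z < 1 \<Longrightarrow> mob p q z = \<zeta> * z" and \<zeta>: "cmod \<zeta> = 1"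
  shows "\<exists>C S. conjugation_l2 C \<and> (\<forall>x y. cip (comp_l2 p q x) y = cip x (S y)) \<and>
       (\<forall>x. comp_l2 p q x = C (S (C x)))"
proof -
  define J where "J = conj_l2 1"
  have J: "conjugation_l2 J" by (simp add: J_def conjugation_conj_l2)
  have T: "coord (comp_l2 p q x) n = \<zeta> ^ n * coord x n" for x n
  proof -
    have "summable (\<lambda>n. (cmod (\<zeta> ^ n * coord x n))\<^sup>2)"
      by (simp add: norm_mult norm_power \<zeta> summable_coord)
    then obtain y where y: "coord y = (\<lambda>n. \<zeta> ^ n * coord x n)" using coord_Abs by metis
    have "comp_l2 p q x = y"
    proof (rule hardy_fun_eq_discI)
      fix z assume z: "cmod z < 1"
      have "cmod (\<zeta> * z) < 1" using z \<zeta> by (simp add: norm_mult)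
      from hardy_fun_sums[OF this, of x] have "(\<lambda>n. coord y n * z ^ n) sums hardy_fun x (\<zeta> * z)"
        by (simp add: y power_mult_distrib mult_ac)
      then have "hardy_fun y z = hardy_fun x (\<zeta> * z)" by (rule sums_unique2[OF hardy_fun_sums[OF z]])
      then show "hardy_fun (comp_l2 p q x) z = hardy_fun y z"
        by (simp add: hardy_fun_comp_l2[OF pq z] rot z)
    qed
    then show ?thesis by (simp add: y)
  qed
  \<comment> \<open>In coordinates this is the diagonal operator with entries
    \<open>cnj \<zeta> ^ n\<close>, the adjoint of the diagonal operator with entries
    \<open>\<zeta> ^ n\<close>.\<close>
  define S where "S x = J (comp_l2 p q (J x))" for x
  have "cip (comp_l2 p q x) y = cip x (S y)" for x y
    by (simp add: cip_def T S_def J_def coord_conj_l2 mult_ac)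
  moreover have "comp_l2 p q x = J (S (J x))" for x
    using J by (simp add: S_def conjugation_l2_def)
  ultimately show ?thesis using J by blast
qed

text \<open>Vanishing trace \<open>p + cnj p\<close> makes \<open>mob p q\<close> an involution. Its
  polar factor \<open>U\<close> intertwines \<open>T\<close> and its adjoint; composing
  \<open>U\<close> with a commuting reflection \<open>J\<close> makes it conjugate-linear and keeps
  it an involution.\<close>

lemma complex_symmetric_involution:
  assumes pq: "cmod q < cmod p" and q0: "q \<noteq> 0" and p: "p + cnj p = 0"
  shows "\<exists>C S. conjugation_l2 C \<and> (\<forall>x y. cip (comp_l2 p q x) y = cip x (S y)) \<and>
       (\<forall>x. comp_l2 p q x = C (S (C x)))"
proof -
  define T where "T = comp_l2 p q"
  have T: "bounded_linear T" unfolding T_def by (rule bounded_linear_comp_l2[OF pq])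
  have Tsc: "T (sc c x) = sc c (T x)" for c x by (simp add: T_def comp_l2_sc pq)
  have cp: "cnj p = - p" using p by (simp add: add_eq_0_iff)
  have invol: "mob p q (mob p q z) = z" if "cmod z < 1" for z
  proof -
    have "p * p + q * cnj q \<noteq> 0"
    proof
      assume "p * p + q * cnj q = 0"
      then have "cmod (p * p) = cmod (q * cnj q)" by (metis add_eq_0_iff norm_minus_cancel)
      then have "(cmod p)\<^sup>2 = (cmod q)\<^sup>2" by (simp add: norm_mult power2_eq_square)
      then show False using pq by (simp add: power2_eq_iff_nonneg)
    qed
    moreover have "p * q + q * cnj p = 0" "cnj (p * p + q * cnj q) = p * p + q * cnj q"
      by (simp_all add: cp)
    ultimately show ?thesis
      unfolding mob_compose[OF pq pq that] by (simp add: mob_def mult.commute[of "cnj q"])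
  qed
  have TT: "T (T x) = x" for x
    unfolding T_def
    by (rule hardy_fun_eq_discI) (simp add: hardy_fun_comp_l2[OF pq] norm_mob_less_1[OF pq] invol)
  obtain S where S: "bounded_linear S" "\<And>c x. S (sc c x) = sc c (S x)" "\<And>x y. cip (T x) y = cip x (S y)"
    using adjoint_l2_exists[OF T Tsc] by blast
  \<comment> \<open>The map sending \<open>z\<close> to \<open>\<omega> * cnj z\<close> is the
    reflection in the real line spanned by \<open>\<i> * q\<close>. It commutes with
    \<open>mob p q\<close> because \<open>\<omega> * cnj q = - q\<close> and
    \<open>cnj p = - p\<close>.\<close>
  define \<omega> where "\<omega> = - q / cnj q"
  have \<omega>: "cmod \<omega> = 1" using q0 by (simp add: \<omega>_def norm_divide)
  have \<omega>q: "\<omega> * cnj q = - q" using q0 by (simp add: \<omega>_def)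
  have reflect: "mob p q (\<omega> * cnj z) = \<omega> * cnj (mob p q z)" for z
  proof -
    have "mob p q (\<omega> * cnj z) = (p * \<omega> * cnj z + q) / (- (q * cnj z + p))"
      using \<omega>q by (simp add: mob_def cp) (metis mult.assoc mult.commute mult_minus_left)
    also have "\<dots> = (- p * \<omega> * cnj z - q) / (q * cnj z + p)"
      by (metis (no_types, lifting) minus_add_distrib minus_diff_eq minus_divide_divide minus_mult_left uminus_add_conv_diff diff_minus_eq_add minus_minus add.commute)
    also have "\<dots> = \<omega> * cnj (mob p q z)"
      using \<omega>q by (simp add: mob_def cp algebra_simps)
    finally show ?thesis .
  qed
  define J where "J = conj_l2 \<omega>"
  have J: "conjugation_l2 J" unfolding J_def by (rule conjugation_conj_l2[OF \<omega>])
  then have Jadd: "J (x + y) = J x + J y" and Jsc: "J (sc c x) = sc (cnj c) (J x)"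
    and Jn: "norm (J x) = norm x" and JJ: "J (J x) = x" for x y c
    by (auto simp: conjugation_l2_def)
  have blJ: "bounded_linear J"
    by (rule bounded_linear_intro[where K = 1]) (simp_all add: Jadd Jsc Jn scaleR_sc)
  have JT: "J (T x) = T (J x)" for x
  proof (rule hardy_fun_eq_discI)
    fix z assume z: "cmod z < 1"
    then have "cmod (\<omega> * cnj z) < 1" using \<omega> by (simp add: norm_mult)
    with z show "hardy_fun (J (T x)) z = hardy_fun (T (J x)) z"
      by (simp add: J_def T_def hardy_fun_conj_l2[OF \<omega>] hardy_fun_comp_l2[OF pq] norm_mob_less_1[OF pq] reflect)
  qed
  have JS: "J (S x) = S (J x)" for x
  proof -
    have "cip y (J (S x)) = cip y (S (J x))" for y
    proof -
      have "cip y (J (S x)) = cip (S x) (J y)"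
        using conjugation_cip[OF J, of "J y" "S x"] by (simp add: JJ)
      also have "\<dots> = cnj (cip (T (J y)) x)" by (simp add: S(3) cnj_cip)
      also have "\<dots> = cip x (J (T y))" by (simp add: cnj_cip JT)
      also have "\<dots> = cip (T y) (J x)"
        using conjugation_cip[OF J, of "T y" "J x"] conjugation_cip[OF J, of "J (T y)" x]
        by (simp add: JJ)
      also have "\<dots> = cip y (S (J x))" by (rule S(3))
      finally show ?thesis .
    qed
    then have "cip (J (S x) - S (J x)) (J (S x) - S (J x)) = 0" by (simp only: cip_simps) simp
    then show ?thesis by simp
  qed
  note ap = bounded_linear_Blinfun_apply
  obtain U where U: "self_adjoint U" "\<And>x. U (U x) = x" "\<And>x. T (U x) = U (S x)"
    "\<And>Z. Z o\<^sub>L Blinfun T = Blinfun T o\<^sub>L Z \<Longrightarrow> Z o\<^sub>L Blinfun S = Blinfun S o\<^sub>L Z \<Longrightarrow> Z o\<^sub>L U = U o\<^sub>L Z"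
  proof (rule involution_polar_factor[of "Blinfun T" "Blinfun S"])
    show "blinfun_apply (Blinfun T) x \<bullet> y = x \<bullet> blinfun_apply (Blinfun S) y" for x y
      using arg_cong[OF S(3)[of x y], of Re] by (simp add: ap T S(1) Re_cip)
  qed (auto simp: ap T S TT)
  have Ucomm: "Z (U x) = U (Z x)" if "bounded_linear Z" "\<And>x. Z (T x) = T (Z x)" "\<And>x. Z (S x) = S (Z x)" for Z x
  proof -
    have "Blinfun Z o\<^sub>L U = U o\<^sub>L Blinfun Z"
      using that by (intro U(4) blinfun_eqI) (simp_all add: ap T S)
    from arg_cong[OF this, of "\<lambda>B. blinfun_apply B x"] show ?thesis by (simp add: ap that)
  qed
  \<comment> \<open>\<open>U\<close> was built as a real operator. Multiplication by
    \<open>c\<close> commutes with \<open>T\<close> and \<open>S\<close>, hence with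
    \<open>U\<close>, which is therefore complex linear.\<close>
  have Usc: "U (sc c x) = sc c (U x)" for c x
    by (rule Ucomm[symmetric]) (simp_all add: bounded_linear_sc Tsc S)
  have UJ: "U (J x) = J (U x)" for x
    by (rule Ucomm[symmetric]) (simp_all add: blJ JT JS)
  have Un: "norm (U x) = norm x" for x
    using U(1,2) by (simp add: norm_eq_sqrt_inner self_adjoint_def)
  define C where "C x = U (J x)" for x
  have "conjugation_l2 C"
    by (simp add: conjugation_l2_def C_def Jadd Jsc Jn JJ blinfun.add_right Usc Un UJ[symmetric] U(2))
  moreover have "T x = C (S (C x))" for x
  proof -
    have "C (S (C x)) = U (S (U x))" by (simp add: C_def JS UJ[symmetric] JJ)
    also have "\<dots> = T x" by (simp add: U(2) U(3)[symmetric])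
    finally show ?thesis by simp
  qed
  ultimately show ?thesis using S(3) unfolding T_def by blast
qed

section \<open>The remaining automorphisms\<close>

lemma cip_total_eqI: "(\<And>n. cip x (e n) = cip y (e n)) \<Longrightarrow> (\<And>x. (\<And>n. cip x (e n) = 0) \<Longrightarrow> x = 0) \<Longrightarrow> x = y"
  by (metis cip_diff_left right_minus_eq)

text \<open>
  With \<open>w\<close> the (unnormalised) dual system of \<open>e\<close>, the bilinear forms \<open>cip (C (e m)) (e n)\<close> and
  \<open>cip (C (w m)) (w n)\<close> both vanish unless \<open>\<mu> ^ m = \<mu> ^ n\<close>. As \<open>w\<close> is a three-term combination of
  \<open>e\<close>, this overdetermines the forms when \<open>\<mu>\<^sup>2 \<noteq> 1\<close>.
\<close>

lemma no_conjugation_toeplitz_eigenvectors: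
  fixes a :: real and \<mu> :: complex
  assumes C: "conjugation_l2 C" and adj: "\<And>x y. cip (T x) y = cip x (S y)"
    and TCS: "\<And>x. T x = C (S (C x))"
    and eig: "\<And>n. T (e n) = sc (\<mu> ^ n) (e n)"
    and gram: "\<And>m n. cip (e m) (e n) = of_real (a ^ ((m - n) + (n - m)))"
    and total: "\<And>x. (\<And>n. cip x (e n) = 0) \<Longrightarrow> x = 0"
    and a: "0 < a" "a < 1" and \<mu>: "\<mu> \<noteq> 0" "\<mu>\<^sup>2 \<noteq> 1"
  shows False
proof -
  have Cadd: "C (x + y) = C x + C y" and Csc: "C (sc c x) = sc (cnj c) (C x)"
    and Cn: "norm (C x) = norm x" and CC: "C (C x) = x" for x y c
    using C by (auto simp: conjugation_l2_def)
  have Cdiff: "C (x - y) = C x - C y" for x y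
    using Cadd[of "x - y" y] by simp
  define p :: complex where "p = 1 + (of_real a)\<^sup>2"
  define b :: complex where "b = of_real a"
  have b0: "b \<noteq> 0" using a by (simp add: b_def)
  have cb: "cnj b = b" "cnj p = p" by (simp_all add: b_def p_def)
  have pb: "p = 1 + b * b" by (simp add: p_def b_def power2_eq_square)
  \<comment> \<open>The Toeplitz matrix of powers of \<open>a\<close> has a tridiagonal inverse.
    These are its columns applied to \<open>e\<close> and scaled by \<open>1 - a\<^sup>2\<close>;
    the corner entry is \<open>1\<close> in place of \<open>1 + a\<^sup>2\<close>.\<close>
  define w where "w n = (case n of 0 \<Rightarrow> e 0 - sc b (e 1)
      | Suc n \<Rightarrow> sc p (e (Suc n)) - sc b (e n) - sc b (e (Suc (Suc n))))" for n
  have w0: "w 0 = e 0 - sc b (e 1)" and wS: "w (Suc n) = sc p (e (Suc n)) - sc b (e n) - sc b (e (Suc (Suc n)))" for n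
    by (simp_all add: w_def)
  have G: "cip (e m) (e n) = b ^ ((m - n) + (n - m))" for m n by (simp add: gram b_def)
  have dual: "cip (e m) (w n) = 0" if mn: "m \<noteq> n" for m n
  proof (cases n)
    case 0
    with that obtain d where "m = Suc d" by (cases m) auto
    with 0 show ?thesis by (simp add: w0 cip_simps G cb)
  next
    case (Suc k)
    consider "m \<le> k" | "m \<ge> Suc (Suc k)" using mn Suc by linarith
    then show ?thesis
    proof cases
      case 1
      then obtain d where "k = m + d" using le_Suc_ex by blast
      with Suc show ?thesis by (simp add: wS cip_simps G cb pb algebra_simps)
    next
      case 2
      then obtain d where "m = Suc (Suc k) + d" using le_Suc_ex by blast
      with Suc show ?thesis by (simp add: wS cip_simps G cb pb algebra_simps Suc_diff_le)
    qed
  qed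
  \<comment> \<open>By biorthogonality both sides have the same inner product with every
    \<open>e m\<close>, and the \<open>e m\<close> are total.\<close>
  have Sw: "S (w n) = sc (cnj (\<mu> ^ n)) (w n)" for n
  proof (rule cip_total_eqI[OF _ total])
    fix m
    have "cip (e m) (S (w n)) = \<mu> ^ m * cip (e m) (w n)" by (simp add: adj[symmetric] eig cip_simps)
    also have "\<dots> = \<mu> ^ n * cip (e m) (w n)" using dual[of m n] by (cases "m = n") auto
    finally have "cnj (cip (e m) (S (w n))) = cnj (\<mu> ^ n * cip (e m) (w n))" by simp
    then show "cip (S (w n)) (e m) = cip (sc (cnj (\<mu> ^ n)) (w n)) (e m)"
      by (simp add: cnj_cip cip_simps)
  qed
  \<comment> \<open>\<open>C (w m)\<close> is an eigenvector of \<open>T\<close> for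
    \<open>\<mu> ^ m\<close>, and \<open>w n\<close> one of the adjoint for
    \<open>cnj (\<mu> ^ n)\<close>.\<close>
  have D: "cip (C (w m)) (w n) = 0" if "\<mu> ^ m \<noteq> \<mu> ^ n" for m n
  proof -
    have "\<mu> ^ m * cip (C (w m)) (w n) = cip (T (C (w m))) (w n)"
      by (simp add: TCS CC Sw Csc cip_simps)
    also have "\<dots> = \<mu> ^ n * cip (C (w m)) (w n)"
      by (simp add: adj Sw cip_simps)
    finally show ?thesis using that by simp
  qed
  define B where "B m n = cip (C (e m)) (e n)" for m n
  have B: "B m n = 0" if "\<mu> ^ m \<noteq> \<mu> ^ n" for m n
  proof -
    have SC: "S (C (e m)) = C (T (e m))" by (simp add: TCS CC)
    have "cip (T (e n)) (C (e m)) = cip (e n) (S (C (e m)))" by (rule adj)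
    also have "\<dots> = cip (e n) (sc (cnj (\<mu> ^ m)) (C (e m)))" by (simp add: SC eig Csc)
    finally have "\<mu> ^ n * cip (e n) (C (e m)) = \<mu> ^ m * cip (e n) (C (e m))"
      by (simp add: eig cip_simps)
    then have "cip (e n) (C (e m)) = 0" using that by simp
    then show ?thesis unfolding B_def by (metis cnj_cip complex_cnj_zero)
  qed
  \<comment> \<open>The coefficients of \<open>C (w 0)\<close> against \<open>e\<close>. The
    vanishing of \<open>B\<close> restricts their support, and \<open>D\<close> in row
    \<open>0\<close> gives a three-term recurrence. If all of them vanish, then
    \<open>w 0 = 0\<close>, which is false.\<close>
  define s where "s k = B 0 k - b * B 1 k" for k
  have s: "cip (C (w 0)) (e k) = s k" for k
    by (simp add: w0 Cdiff Csc cip_simps s_def B_def cb)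
  have s0: "s k = 0" if "\<mu> ^ k \<noteq> 1" "\<mu> ^ k \<noteq> \<mu>" for k
    using B[of 0 k] B[of 1 k] that by (simp add: s_def)
  have sw: "p * s (Suc k) - b * s k - b * s (Suc (Suc k)) = 0" if "\<mu> ^ Suc k \<noteq> 1" for k
    using D[of 0 "Suc k"] that by (simp add: wS cip_simps s cb)
  have sw': "p * s (k + 1) - b * s k - b * s (k + 2) = 0" if "\<mu> ^ (k + 1) \<noteq> 1" for k
    using sw[of k] that by simp
  have sw'': "p * s (k + 2) - b * s (k + 1) - b * s (k + 3) = 0" if "\<mu> ^ (k + 2) \<noteq> 1" for k
    using sw[of "Suc k"] that by (simp add: numeral_3_eq_3)
  have l: "\<mu> \<noteq> 1" "\<mu>\<^sup>2 \<noteq> \<mu>" "\<mu> ^ Suc (Suc 0) \<noteq> 1"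
    using \<mu> by (auto simp: power2_eq_square)
  have p0: "p \<noteq> 0" and pb0: "p * p - b * b \<noteq> 0"
  proof -
    have pr: "p = of_real (1 + a\<^sup>2)" by (simp add: p_def)
    have "1 + a\<^sup>2 \<noteq> 0" using zero_le_power2[of a] by linarith
    then show "p \<noteq> 0" unfolding pr of_real_eq_0_iff .
    have "a * a < 1 * 1" using a by (intro mult_strict_mono) auto
    also have "\<dots> \<le> (1 + a\<^sup>2) * (1 + a\<^sup>2)"
      by (intro mult_mono) auto
    finally have "(1 + a\<^sup>2) * (1 + a\<^sup>2) - a * a \<noteq> 0" by simp
    moreover have "p * p - b * b = of_real ((1 + a\<^sup>2) * (1 + a\<^sup>2) - a * a)"
      unfolding pr b_def by (simp only: of_real_mult of_real_diff)
    ultimately show "p * p - b * b \<noteq> 0" by (simp only: of_real_eq_0_iff not_False_eq_True)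
  qed
  have "s k = 0" for k
  \<comment> \<open>After an index \<open>k\<close> with \<open>\<mu> ^ k = \<mu>\<close> the next
    two powers are \<open>\<mu>\<^sup>2\<close> and \<open>\<mu> ^ 3\<close>. Unless
    \<open>\<mu> ^ 3 = 1\<close>, both differ from \<open>1\<close> and \<open>\<mu>\<close>, so
    \<open>s\<close> vanishes there and the recurrence gives \<open>s k = 0\<close>.\<close>
  proof (cases "\<mu> ^ 3 = 1")
    case False
    then have l3: "\<mu> ^ 3 \<noteq> \<mu>" using \<mu> by (auto simp: power3_eq_cube power2_eq_square)
    have s1: "s k = 0" if "\<mu> ^ k = \<mu>" for k
    proof -
      have "\<mu> ^ Suc k = \<mu>\<^sup>2" "\<mu> ^ Suc (Suc k) = \<mu> ^ 3"
        using that by (simp_all add: power2_eq_square power3_eq_cube mult.assoc)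
      then have "s (Suc k) = 0" "s (Suc (Suc k)) = 0" "p * s (Suc k) - b * s k - b * s (Suc (Suc k)) = 0"
        using l(2) l3 \<mu>(2) False by (metis s0, metis s0, metis sw)
      then show ?thesis using b0 by simp
    qed
    consider "\<mu> ^ k = 1" | "\<mu> ^ k = \<mu>" | "\<mu> ^ k \<noteq> 1" "\<mu> ^ k \<noteq> \<mu>" by blast
    then show ?thesis
    proof cases
      case 1
      have e: "\<mu> ^ Suc k = \<mu>" "\<mu> ^ Suc (Suc k) = \<mu>\<^sup>2"
        using 1 by (simp_all add: power2_eq_square)
      then have "s (Suc (Suc k)) = 0" "p * s (Suc k) - b * s k - b * s (Suc (Suc k)) = 0"
        using l(1,2) \<mu>(2) by (metis s0, metis sw)
      then show ?thesis using b0 s1[OF e(1)] by simp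
    qed (rule s1, assumption, rule s0)
  next
    case True
    have pw: "\<mu> ^ (3 * j) = 1" "\<mu> ^ (3 * j + 1) = \<mu>" "\<mu> ^ (3 * j + 2) = \<mu>\<^sup>2" for j
      by (simp_all add: power_add power_mult True power2_eq_square)
    have s2: "s (3 * j + 2) = 0" for j
      by (rule s0) (simp_all only: pw, use \<mu> l in auto)
    have e1: "p * s (3 * j + 1) = b * s (3 * j)" for j
    proof -
      have "p * s (3 * j + 1) - b * s (3 * j) - b * s (3 * j + 2) = 0"
        by (rule sw') (simp only: pw l(1) not_False_eq_True)
      then show ?thesis by (simp only: s2 mult_zero_right diff_zero right_minus_eq)
    qed
    have e2: "s (3 * j + 3) = - s (3 * j + 1)" for j
    proof -
      have "p * s (3 * j + 2) - b * s (3 * j + 1) - b * s (3 * j + 3) = 0"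
        by (rule sw'') (simp only: pw \<mu>(2) not_False_eq_True)
      moreover have "b * (X + Y) = - (p * 0 - b * X - b * Y)" for X Y
        by (simp add: algebra_simps)
      ultimately have "b * (s (3 * j + 1) + s (3 * j + 3)) = - 0"
        by (simp only: s2)
      then have "s (3 * j + 1) + s (3 * j + 3) = 0" using b0 by (simp only: minus_zero mult_eq_0_iff) blast
      then show ?thesis by (metis add_eq_0_iff)
    qed
    \<comment> \<open>For \<open>\<mu> ^ 3 = 1\<close> the relations \<open>e1\<close> and
      \<open>e2\<close> leave \<open>s 0\<close> free. The coefficients of \<open>C (w 1)\<close>
      supply the missing equations, in columns \<open>2\<close> and \<open>3\<close>.\<close>
    define t where "t k = p * B 1 k - b * B 0 k - b * B 2 k" for k
    have t: "cip (C (w 1)) (e k) = t k" for k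
      using wS[of 0] by (simp add: Cdiff Csc cip_simps t_def B_def cb numeral_2_eq_2)
    have l4: "\<mu> ^ 4 = \<mu>" using pw(2)[of 1] by simp
    have Bz: "B 1 3 = 0" "B 2 3 = 0" "B 0 1 = 0" "B 2 1 = 0" "B 0 4 = 0" "B 2 4 = 0"
      using \<mu>(2) l(1,2) True by (auto intro!: B simp: l4)
    have t3: "t 3 = - b * s 3" and t1: "b * t 1 = - p * s 1" and t4: "b * t 4 = - p * s 4"
      by (simp_all add: t_def s_def Bz del: One_nat_def)
    have d2: "p * t 2 - b * t 1 - b * t 3 = 0"
    proof -
      have w2: "w 2 = sc p (e 2) - sc b (e 1) - sc b (e 3)"
        using wS[of 1] by (simp add: eval_nat_numeral)
      have "cip (C (w 1)) (w 2) = 0" by (rule D) (use l(2) in auto)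
      then show ?thesis by (simp only: w2 cip_simps t cb)
    qed
    have d3: "p * t 3 - b * t 2 - b * t 4 = 0"
    proof -
      have w3: "w 3 = sc p (e 3) - sc b (e 2) - sc b (e 4)"
        using wS[of 2] by (simp add: eval_nat_numeral)
      have "cip (C (w 1)) (w 3) = 0" by (rule D) (use l(1) True in auto)
      then show ?thesis by (simp only: w3 cip_simps t cb)
    qed
    have s3: "s 3 = - s 1" and s4: "p * s 4 = b * s 3"
      using e2[of 0] e1[of 1] by simp_all
    \<comment> \<open>Elimination of \<open>t 2\<close> from \<open>d2\<close> and
      \<open>d3\<close>, with the other \<open>t\<close> values expressed by \<open>s 1\<close>; the
      factor is nonzero since \<open>p\<close> exceeds \<open>1\<close> and \<open>a\<close> does
      not.\<close>
    have "b * ((p * p - b * b) * s 1) = 0"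
    proof -
      have "b * t 4 = b * s 1" using t4 s4 s3 by simp
      have "p * (p * t 3) = b * (p * t 2) + p * (b * t 4)" using d3 by (simp add: algebra_simps)
      also have "p * t 2 = b * t 1 + b * t 3" using d2 by (simp add: algebra_simps)
      finally show ?thesis
        unfolding \<open>b * t 4 = b * s 1\<close> t1 t3 s3 by (simp add: algebra_simps)
    qed
    then have "s 1 = 0" using b0 pb0 by simp
    then have s00: "s 0 = 0" using e1[of 0] b0 by simp
    have s3j: "s (3 * j) = 0" for j
    proof (induction j)
      case (Suc j)
      then have "s (3 * j + 1) = 0" using e1[of j] p0 by simp
      then show ?case using e2[of j] by (simp add: add.commute)
    qed (simp add: s00)
    have "s (3 * j + 1) = 0" for j using e1[of j] s3j[of j] p0 by simp
    then show ?thesis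
      using s3j[of "k div 3"] s2[of "k div 3"] mult_div_mod_eq[of 3 k]
      by (metis One_nat_def Suc_1 add.right_neutral less_2_cases less_antisym mod_less_divisor
          numeral_3_eq_3 zero_less_numeral)
  qed
  then have "C (w 0) = 0" by (intro total) (simp add: s)
  then have "w 0 = 0" using Cn[of "w 0"] by simp
  moreover have "cip (e 0) (w 0) = of_real (1 - a * a)"
    by (simp add: w0 cip_simps G cb) (simp add: b_def)
  ultimately have "1 - a * a = 0" by (metis cip_zero(2) of_real_eq_0_iff)
  moreover have "a * a < 1 * 1" using a by (intro mult_strict_mono) auto
  ultimately show False by simp
qed

section \<open>Elliptic automorphisms with a nonzero fixed point\<close>

text \<open>Conjugation by an automorphism that takes \<open>a\<close> to \<open>0\<close> turns
  \<open>mob p q\<close> into a rotation. The phase \<open>u\<close> stays free, to be used for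
  making a Gram matrix real.\<close>

lemma mob_fixed_point_multiplier:
  assumes pq: "cmod q < cmod p" and a: "cmod a < 1" and fp: "mob p q a = a"
    and u: "cmod u = 1" and z: "cmod z < 1"
  shows "mob u (- u * a) (mob p q z) = (p - a * cnj q) / cnj (p - a * cnj q) * mob u (- u * a) z"
proof -
  have u0: "u \<noteq> 0" using u by auto
  have ua: "cmod (- u * a) < cmod u" using u a by (simp add: norm_mult)
  define P where "P = p - a * cnj q"
  have "cmod (a * cnj q) \<le> 1 * cmod q" using a by (simp add: norm_mult mult_left_le_one_le)
  then have P0: "P \<noteq> 0" using pq by (auto simp: P_def)
  \<comment> \<open>The fixed point equation, rearranged so that \<open>P\<close> factors out of
    both entries of the matrix product.\<close>
  have Q: "q - a * cnj p = - a * P"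
  proof -
    have "p * a + q = a * (cnj q * a + cnj p)"
      using fp mob_denominator_nonzero[OF pq, of a] a by (simp add: mob_def field_simps)
    then show ?thesis by (simp add: P_def algebra_simps)
  qed
  have "mob u (- u * a) (mob p q z) = mob (u * p + (- u * a) * cnj q) (u * q + (- u * a) * cnj p) z"
    by (rule mob_compose[OF ua pq z])
  also have "u * p + (- u * a) * cnj q = u * P" by (simp add: P_def algebra_simps)
  also have "u * q + (- u * a) * cnj p = - u * a * P"
    using Q by (metis (no_types, lifting) mult.assoc mult_minus_left mult_minus_right right_diff_distrib diff_conv_add_uminus)
  also have "mob (u * P) (- u * a * P) z = (u * P * (z - a)) / (cnj u * cnj P * (1 - cnj a * z))"
    by (simp add: mob_def algebra_simps)
  also have "\<dots> = P / cnj P * ((u * (z - a)) / (cnj u * (1 - cnj a * z)))"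
    by (simp add: mult_ac)
  also have "(u * (z - a)) / (cnj u * (1 - cnj a * z)) = mob u (- u * a) z"
    by (simp add: mob_def algebra_simps)
  finally show ?thesis unfolding P_def .
qed

lemma mob_inverse:
  assumes "cmod q < cmod p" "cmod z < 1"
  shows "mob (cnj p) (- q) (mob p q z) = z"
proof -
  have pq: "cmod (- q) < cmod (cnj p)" using assms(1) by simp
  have "cnj p * p - q * cnj q = complex_of_real ((cmod p)\<^sup>2 - (cmod q)\<^sup>2)"
    by (simp only: of_real_diff complex_norm_square mult.commute)
  moreover have "(cmod p)\<^sup>2 - (cmod q)\<^sup>2 \<noteq> 0" using assms(1) by (simp add: power2_eq_iff_nonneg)
  ultimately have "cnj p * p - q * cnj q \<noteq> 0" by (metis of_real_eq_0_iff)
  moreover have "cnj p * q + - q * cnj p = 0" by simp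
  moreover have "cnj (cnj p * p - q * cnj q) = cnj p * p - q * cnj q" by (simp add: mult.commute)
  ultimately show ?thesis
    unfolding mob_compose[OF pq assms] by (simp add: mob_def mult.commute)
qed

text \<open>The powers of \<open>mob u Q\<close> are eigenvectors for the powers of the multiplier,
  so the previous obstruction forces \<mu>\<open>\<^sup>2 = 1\<close>; since \<open>mob u Q\<close>
  is injective on the disc, the second iterate is then the identity.\<close>

lemma elliptic_complex_symmetric_imp_involution:
  assumes pq: "cmod q < cmod p" and a: "cmod a < 1" "a \<noteq> 0" and fp: "mob p q a = a"
    and C: "conjugation_l2 C" and adj: "\<And>x y. cip (comp_l2 p q x) y = cip x (S y)"
    and TCS: "\<And>x. comp_l2 p q x = C (S (C x))" and z: "cmod z < 1"
  shows "mob p q (mob p q z) = z"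
proof (rule ccontr)
  assume neq: "mob p q (mob p q z) \<noteq> z"
  define \<mu> where "\<mu> = (p - a * cnj q) / cnj (p - a * cnj q)"
  \<comment> \<open>Chosen so that \<open>mob u Q 0 = - a * u * u\<close> is the positive number
    \<open>cmod a\<close>; the Gram matrix then has the real entries that the obstruction
    requires.\<close>
  define u where "u = csqrt (- cnj a / of_real (cmod a))"
  have u2: "u * u = - cnj a / of_real (cmod a)"
    by (simp add: u_def power2_eq_square[symmetric])
  have "cmod u * cmod u = 1" using u2 a(2) by (metis norm_mult norm_divide norm_minus_cancel complex_mod_cnj norm_of_real abs_norm_cancel divide_self norm_eq_zero)
  then have u: "cmod u = 1" by (metis norm_ge_zero mult_1 power2_eq_1_iff power2_eq_square neg_0_le_iff_le not_one_le_zero)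
  then have uc: "u * cnj u = 1" by (simp add: complex_norm_square[symmetric])
  then have ui: "1 / cnj u = u" using u by (metis nonzero_eq_divide_eq complex_cnj_zero_iff norm_zero zero_neq_one)
  define Q where "Q = - u * a"
  have uQ: "cmod Q < cmod u" using u a by (simp add: Q_def norm_mult)
  have Qu: "Q / cnj u = of_real (cmod a)"
  proof -
    have "Q / cnj u = Q * (1 / cnj u)" by simp
    also have "\<dots> = - a * (u * u)" unfolding ui by (simp add: Q_def)
    also have "\<dots> = of_real (cmod a)"
      using a(2) unfolding u2 by (simp add: field_simps power2_eq_square[symmetric] complex_norm_square[symmetric] del: of_real_power)
        (simp add: power2_eq_square)
    finally show ?thesis .
  qed
  note mult = mob_fixed_point_multiplier[OF pq a(1) fp u, folded \<mu>_def Q_def]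
  have \<mu>0: "\<mu> \<noteq> 0"
  proof -
    have "cmod (a * cnj q) \<le> 1 * cmod q" using a by (simp add: norm_mult mult_left_le_one_le)
    then have "p - a * cnj q \<noteq> 0" using pq by auto
    then show ?thesis unfolding \<mu>_def divide_eq_0_iff complex_cnj_zero_iff by blast
  qed
  have \<mu>2: "\<mu>\<^sup>2 \<noteq> 1"
  proof
    assume "\<mu>\<^sup>2 = 1"
    then have "mob u Q (mob p q (mob p q z)) = mob u Q z"
      using z norm_mob_less_1[OF pq z] by (simp add: mult mult.assoc[symmetric] power2_eq_square)
    then show False
      using neq z mob_inverse[OF uQ] norm_mob_less_1[OF pq] by metis
  qed
  interpret A: bounded_linear "comp_l2 u Q" by (rule bounded_linear_comp_l2[OF uQ])
  show False
  proof (rule no_conjugation_toeplitz_eigenvectors[OF C adj TCS, of "mob_power u Q" \<mu> "cmod a"])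
    show "comp_l2 p q (mob_power u Q n) = sc (\<mu> ^ n) (mob_power u Q n)" for n
      by (rule hardy_fun_eq_discI)
         (simp add: hardy_fun_comp_l2[OF pq] hardy_fun_mob_power[OF uQ] hardy_fun_sc norm_mob_less_1[OF pq] mult power_mult_distrib)
    show "cip (mob_power u Q m) (mob_power u Q n) = of_real (cmod a ^ ((m - n) + (n - m)))" for m n
    proof (cases "n \<le> m")
      case True
      then show ?thesis by (simp add: cip_mob_power[OF uQ] Qu)
    next
      case False
      then have "cip (mob_power u Q m) (mob_power u Q n) = cnj ((Q / cnj u) ^ (n - m))"
        by (metis cip_mob_power[OF uQ] cnj_cip nat_le_linear)
      with False show ?thesis by (simp add: Qu)
    qed
    \<comment> \<open>Totality: composition with \<open>mob u Q\<close> carries the monomials to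
      these powers and is surjective, so \<open>x\<close> is orthogonal to the whole space, itself
      included.\<close>
    fix x assume orth: "\<And>n. cip x (mob_power u Q n) = 0"
    have basis: "comp_l2 u Q (basis_l2 k) = mob_power u Q k" for k
      by (rule hardy_fun_eq_discI)
         (simp add: hardy_fun_comp_l2[OF uQ] hardy_fun_mob_power[OF uQ] hardy_fun_basis norm_mob_less_1[OF uQ])
    have "cip (comp_l2 u Q y) x = 0" for y
    proof (rule bounded_linear_eqI[of "\<lambda>y. cip (comp_l2 u Q y) x" "\<lambda>_. 0"])
      show "bounded_linear (\<lambda>y. cip (comp_l2 u Q y) x)"
        by (rule bounded_linear_compose[OF bounded_linear_cip_left bounded_linear_comp_l2[OF uQ]])
      show "cip (comp_l2 u Q (sc c (basis_l2 k))) x = 0" for k c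
        using orth[of k] cnj_cip[of x "mob_power u Q k"] by (simp add: comp_l2_sc uQ basis cip_simps)
    qed simp
    moreover have "comp_l2 u Q (comp_l2 (cnj u) (- Q) x) = x"
      using uQ by (intro hardy_fun_eq_discI)
        (simp add: hardy_fun_comp_l2 norm_mob_less_1 mob_inverse)
    ultimately have "cip x x = 0" by metis
    then show "x = 0" by simp
  qed (use a \<mu>0 \<mu>2 in auto)
qed

section \<open>Parabolic and hyperbolic automorphisms\<close>

text \<open>At determinant \<open>1\<close> and \<open>q\<close> nonzero, the condition on the trace
  \<open>2 * Re p\<close> means that there is no fixed point in the disc; the orbit of
  \<open>0\<close> then runs to the circle.\<close>

lemma nonelliptic_not_complex_symmetric:
  assumes pq: "(cmod p)\<^sup>2 - (cmod q)\<^sup>2 = 1" and q0: "q \<noteq> 0" and tr: "\<bar>Re p\<bar> \<ge> 1"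
    and C: "conjugation_l2 C" and adj: "\<And>x y. cip (comp_l2 p q x) y = cip x (S y)"
    and TCS: "\<And>x. comp_l2 p q x = C (S (C x))"
  shows False
proof -
  have lt: "cmod q < cmod p" by (rule power_less_imp_less_base[of _ 2]) (use pq in auto)
  \<comment> \<open>The first row of the \<open>n\<close>-th power of the matrix, so
    \<open>mob (P n) (Q n)\<close> is the \<open>n\<close>-th iterate on the disc.\<close>
  define M where "M = rec_nat (1, 0) (\<lambda>_ (r, s). (r * p + s * cnj q, r * q + s * cnj p))"
  define P where "P n = fst (M n)" for n
  define Q where "Q n = snd (M n)" for n
  have PQ0: "P 0 = 1" "Q 0 = 0" by (simp_all add: P_def Q_def M_def)
  have PQS: "P (Suc n) = P n * p + Q n * cnj q" "Q (Suc n) = P n * q + Q n * cnj p" for n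
    by (simp_all add: P_def Q_def M_def split_beta)
  have pq': "p * cnj p - q * cnj q = 1"
    using arg_cong[OF pq, of complex_of_real] by (simp only: of_real_diff complex_norm_square of_real_1)
  have "P n * cnj (P n) - Q n * cnj (Q n) = 1" for n
  proof (induction n)
    case (Suc n)
    have "P (Suc n) * cnj (P (Suc n)) - Q (Suc n) * cnj (Q (Suc n))
        = (P n * cnj (P n) - Q n * cnj (Q n)) * (p * cnj p - q * cnj q)"
      by (simp add: PQS algebra_simps)
    then show ?case by (simp add: Suc.IH pq')
  qed (simp add: PQ0)
  then have "complex_of_real ((cmod (P n))\<^sup>2 - (cmod (Q n))\<^sup>2) = of_real 1" for n
    by (simp only: of_real_diff complex_norm_square of_real_1)
  then have det: "(cmod (P n))\<^sup>2 - (cmod (Q n))\<^sup>2 = 1" for n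
    by (simp only: of_real_eq_iff)
  have PQ: "cmod (Q n) < cmod (P n)" for n
    by (rule power_less_imp_less_base[of _ 2]) (use det[of n] in auto)
  \<comment> \<open>Cayley-Hamilton for a matrix of trace \<open>2 * Re p\<close> and determinant
    \<open>1\<close>.\<close>
  have rec: "Q (Suc (Suc n)) = of_real (2 * Re p) * Q (Suc n) - Q n" for n
  proof -
    have "Q (Suc (Suc n)) = (p + cnj p) * Q (Suc n) - (p * cnj p - q * cnj q) * Q n"
      by (simp add: PQS algebra_simps)
    then show ?thesis by (simp add: pq' complex_add_cnj)
  qed
  \<comment> \<open>Since the trace has modulus at least \<open>2\<close>, the recurrence makes the
    moduli convex in \<open>n\<close>; they grow at least linearly, the first increment being
    \<open>cmod q\<close>.\<close>
  have incr: "cmod (Q (Suc n)) - cmod (Q n) \<ge> cmod q" for n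
  proof (induction n)
    case (Suc n)
    have "2 * cmod (Q (Suc n)) \<le> 2 * \<bar>Re p\<bar> * cmod (Q (Suc n))"
      using tr by (intro mult_right_mono) auto
    also have "\<dots> = cmod (of_real (2 * Re p) * Q (Suc n))" by (simp add: norm_mult)
    also have "\<dots> \<le> cmod (Q (Suc (Suc n))) + cmod (Q n)"
      using norm_triangle_ineq[of "Q (Suc (Suc n))" "Q n"] by (simp add: rec)
    finally show ?case using Suc.IH by simp
  qed (simp add: PQ0 PQS)
  have grow: "cmod (Q n) \<ge> real n * cmod q" for n
  proof (induction n)
    case (Suc n)
    then show ?case using incr[of n] by (simp add: algebra_simps)
  qed simp
  have "filterlim (\<lambda>n. real n * cmod q) at_top sequentially"
    using q0 by (intro filterlim_at_top_mult_tendsto_pos[OF tendsto_const _ filterlim_real_sequentially, of "cmod q"]) simp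
  then have "filterlim (\<lambda>n. cmod (P n)) at_top sequentially"
    by (rule filterlim_at_top_mono)
       (auto intro!: always_eventually less_imp_le[OF le_less_trans[OF grow PQ]])
  then have inv0: "(\<lambda>n. inverse (cmod (P n))) \<longlonglongrightarrow> 0"
    by (rule tendsto_inverse_0_at_top)
  \<comment> \<open>The value of the \<open>n\<close>-th iterate at \<open>0\<close>.\<close>
  define c where "c n = Q n / cnj (P n)" for n
  have P0: "P n \<noteq> 0" for n using PQ[of n] by auto
  have c2: "1 - (cmod (c n))\<^sup>2 = (inverse (cmod (P n)))\<^sup>2" for n
  proof -
    have "(cmod (Q n))\<^sup>2 = (cmod (P n))\<^sup>2 - 1" using det[of n] by simp
    then show ?thesis using P0[of n]
      by (simp add: c_def norm_divide power_divide diff_divide_distrib inverse_eq_divide)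
  qed
  have "(\<lambda>n. sqrt (1 - (inverse (cmod (P n)))\<^sup>2)) \<longlonglongrightarrow> sqrt (1 - 0\<^sup>2)"
    by (intro tendsto_intros inv0)
  moreover have "sqrt (1 - (inverse (cmod (P n)))\<^sup>2) = cmod (c n)" for n
    by (simp add: c2[symmetric])
  ultimately have c1: "(\<lambda>n. cmod (c n)) \<longlonglongrightarrow> 1" by simp
  define g where "g = C (basis_l2 0)"
  have CC: "C (C x) = x" and Cn: "norm (C x) = norm x" for x
    using C by (auto simp: conjugation_l2_def)
  have "comp_l2 p q (basis_l2 0) = basis_l2 0"
    by (rule hardy_fun_eq_discI) (simp add: hardy_fun_comp_l2[OF lt] hardy_fun_basis norm_mob_less_1[OF lt])
  \<comment> \<open>\<open>T\<close> fixes the constant \<open>1\<close>, so its adjoint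
    \<open>S\<close> fixes \<open>g = C 1\<close>.\<close>
  then have Sg: "S g = g" unfolding g_def by (metis TCS CC)
  have iter: "cip (mob_power (P n) (Q n) k) g = cnj (coord g k)" for n k
  proof (induction n)
    case 0
    have "mob_power 1 0 k = basis_l2 k"
      by (rule hardy_fun_eq_discI) (simp add: hardy_fun_mob_power hardy_fun_basis mob_def)
    then show ?case by (simp add: PQ0 cip_basis_left)
  next
    case (Suc n)
    have "mob_power (P (Suc n)) (Q (Suc n)) k = comp_l2 p q (mob_power (P n) (Q n) k)"
      by (rule hardy_fun_eq_discI)
         (simp add: hardy_fun_comp_l2[OF lt] hardy_fun_mob_power[OF PQ] norm_mob_less_1[OF lt]
            mob_compose[OF PQ lt] PQS[symmetric])
    then show ?case by (simp add: adj Sg Suc.IH)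
  qed
  have step: "cmod (coord g (Suc k)) = cmod (coord g k)" for k
  proof -
    have le: "\<bar>cmod (coord g (Suc k)) - cmod (c n) * cmod (coord g k)\<bar> \<le> inverse (cmod (P n)) * norm g" for n
    proof -
      \<comment> \<open>The part of one power orthogonal to the preceding one. Both have norm
        \<open>1\<close> and their inner product is \<open>c n\<close>, so the squared norm is
        \<open>1 - (cmod (c n))\<^sup>2\<close>.\<close>
      define x where "x = mob_power (P n) (Q n) (Suc k) - sc (c n) (mob_power (P n) (Q n) k)"
      have Gs: "cip (mob_power (P n) (Q n) j) (mob_power (P n) (Q n) j) = 1" for j
        by (simp add: cip_mob_power[OF PQ])
      have G1: "cip (mob_power (P n) (Q n) (Suc k)) (mob_power (P n) (Q n) k) = c n"
        by (simp add: cip_mob_power[OF PQ] c_def)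
      then have G2: "cip (mob_power (P n) (Q n) k) (mob_power (P n) (Q n) (Suc k)) = cnj (c n)"
        by (metis cnj_cip)
      have "cip x x = 1 - c n * cnj (c n)"
        by (simp add: x_def cip_simps Gs G1 G2 algebra_simps)
      then have "complex_of_real ((norm x)\<^sup>2) = complex_of_real (1 - (cmod (c n))\<^sup>2)"
        by (simp only: cip_self of_real_diff complex_norm_square of_real_1)
      then have "(norm x)\<^sup>2 = (inverse (cmod (P n)))\<^sup>2" by (simp only: of_real_eq_iff c2)
      then have nx: "norm x = inverse (cmod (P n))" by (simp add: power2_eq_iff_nonneg)
      have "cip x g = cnj (coord g (Suc k)) - c n * cnj (coord g k)"
        by (simp add: x_def cip_simps iter)
      then have "cmod (cnj (coord g (Suc k)) - c n * cnj (coord g k)) \<le> inverse (cmod (P n)) * norm g"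
        using norm_cip_le[of x g] nx by simp
      moreover have "\<bar>cmod (coord g (Suc k)) - cmod (c n) * cmod (coord g k)\<bar> \<le>
          cmod (cnj (coord g (Suc k)) - c n * cnj (coord g k))"
        using norm_triangle_ineq3[of "cnj (coord g (Suc k))" "c n * cnj (coord g k)"] by (simp add: norm_mult)
      ultimately show ?thesis by linarith
    qed
    have "(\<lambda>n. \<bar>cmod (coord g (Suc k)) - cmod (c n) * cmod (coord g k)\<bar>) \<longlonglongrightarrow>
        \<bar>cmod (coord g (Suc k)) - 1 * cmod (coord g k)\<bar>"
      by (intro tendsto_intros c1)
    moreover have "(\<lambda>n. inverse (cmod (P n)) * norm g) \<longlonglongrightarrow> 0 * norm g"
      by (intro tendsto_intros inv0)
    ultimately have "\<bar>cmod (coord g (Suc k)) - 1 * cmod (coord g k)\<bar> \<le> 0 * norm g"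
      by (rule LIMSEQ_le) (use le in auto)
    then show ?thesis by simp
  qed
  have const: "cmod (coord g k) = cmod (coord g 0)" for k
    by (induction k) (simp_all add: step)
  \<comment> \<open>A square summable sequence of constant modulus is zero, whereas \<open>g\<close>
    has norm \<open>1\<close>.\<close>
  have "(\<lambda>k. (cmod (coord g k))\<^sup>2) \<longlonglongrightarrow> 0" by (rule summable_LIMSEQ_zero[OF summable_coord])
  moreover have "(\<lambda>k. (cmod (coord g k))\<^sup>2) = (\<lambda>k. (cmod (coord g 0))\<^sup>2)"
    by (rule ext) (rule arg_cong[OF const])
  ultimately have "coord g 0 = 0" by (simp add: LIMSEQ_const_iff)
  then have "coord g k = 0" for k using const[of k] by simp
  then have "g = 0" by (intro l2_eqI) simp
  then have "basis_l2 0 = 0" using Cn[of "basis_l2 0"] by (simp add: g_def)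
  then have "coord (basis_l2 0) 0 = 0" by simp
  then show False by simp
qed

section \<open>Fixed points and order of Moebius maps\<close>

text \<open>With \<open>w = cnj q * z\<close> the fixed point equation becomes
  \<open>w\<^sup>2 - 2 * \<i> * m * w - (cmod q)\<^sup>2 = 0\<close>. Its roots are
  \<open>\<i> * (m - s)\<close> and \<open>\<i> * (m + s)\<close>, where
  \<open>s\<^sup>2 = 1 - (Re p)\<^sup>2\<close> is positive.\<close>

lemma mob_elliptic_fixed_point:
  assumes pq: "(cmod p)\<^sup>2 - (cmod q)\<^sup>2 = 1" and q0: "q \<noteq> 0" and tr: "\<bar>Re p\<bar> < 1"
  obtains a where "cmod a < 1" "a \<noteq> 0" "mob p q a = a"
proof -
  have lt: "cmod q < cmod p" by (rule power_less_imp_less_base[of _ 2]) (use pq in auto)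
  define m where "m = Im p"
  \<comment> \<open>The factor \<open>sgn m\<close> gives \<open>s\<close> the sign of
    \<open>m\<close>, so that \<open>m - s\<close> belongs to the smaller root. As
    \<open>(m - s) * (m + s) = (cmod q)\<^sup>2\<close>, this root lies inside the disc.\<close>
  define s where "s = sgn m * sqrt (1 - (Re p)\<^sup>2)"
  have re: "(Re p)\<^sup>2 < 1" using tr by (simp add: abs_square_less_1)
  have ms: "m\<^sup>2 - (1 - (Re p)\<^sup>2) = (cmod q)\<^sup>2"
    using pq by (simp add: cmod_power2 m_def)
  have q2: "0 < (cmod q)\<^sup>2" using q0 by simp
  have m0: "m \<noteq> 0"
  proof
    assume "m = 0"
    then have "m\<^sup>2 = 0" by simp
    with ms re q2 show False by linarith
  qed
  then have "(sgn m)\<^sup>2 = 1" by (simp add: sgn_if)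
  then have s2: "s\<^sup>2 = 1 - (Re p)\<^sup>2" using re by (simp add: s_def power_mult_distrib)
  have "s * m = \<bar>m\<bar> * sqrt (1 - (Re p)\<^sup>2)" by (simp add: s_def abs_sgn)
  then have sm: "s * m > 0" using m0 re by simp
  have diff: "(m - s) * (m + s) = (cmod q)\<^sup>2"
    using ms s2 by (simp add: power2_eq_square algebra_simps)
  have "(s * s)\<^sup>2 < (s * m)\<^sup>2"
  proof -
    have "s\<^sup>2 < m\<^sup>2" "0 < s\<^sup>2" using ms s2 q2 re by linarith+
    then have "s\<^sup>2 * s\<^sup>2 < s\<^sup>2 * m\<^sup>2" by (intro mult_strict_left_mono)
    then show ?thesis by (simp add: power2_eq_square mult_ac)
  qed
  then have "s * s < s * m" by (rule power_less_imp_less_base) (use sm in simp)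
  then have less: "(m - s)\<^sup>2 < (cmod q)\<^sup>2"
    using diff by (simp add: power2_eq_square algebra_simps)
  define a where "a = \<i> * of_real (m - s) / cnj q"
  have qa: "cnj q * a = \<i> * of_real (m - s)" using q0 by (simp add: a_def)
  have pc: "p = of_real (Re p) + \<i> * of_real m" by (simp add: complex_eq_iff m_def)
  show ?thesis
  proof (rule that[of a])
    have "cmod a = \<bar>m - s\<bar> / cmod q" by (simp add: a_def norm_mult norm_divide flip: of_real_diff)
    moreover have "\<bar>m - s\<bar> < cmod q"
      by (rule power_less_imp_less_base[of _ 2]) (use less in auto)
    ultimately show "cmod a < 1" using q0 by simp
    then have d: "cnj q * a + cnj p \<noteq> 0" using mob_denominator_nonzero[OF lt] by simp
    have "(m - s) \<noteq> 0" using diff q2 by auto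
    then show "a \<noteq> 0" using q0 by (simp add: a_def flip: of_real_diff)
    have "cnj q * (a * (cnj q * a + cnj p) - (p * a + q)) = 0"
    proof -
      have "cnj q * (a * (cnj q * a + cnj p) - (p * a + q))
          = (cnj q * a) * (cnj q * a + cnj p - p) - q * cnj q"
        by (simp add: algebra_simps)
      also have "cnj p - p = - 2 * \<i> * of_real m"
        by (simp add: complex_eq_iff m_def)
      then have "cnj q * a + cnj p - p = \<i> * of_real (m - s) - 2 * \<i> * of_real m"
        unfolding qa by (simp add: algebra_simps)
      also have "(cnj q * a) * (\<i> * of_real (m - s) - 2 * \<i> * of_real m) = of_real ((m - s) * (m + s))"
        unfolding qa by (simp add: algebra_simps)
      finally show ?thesis unfolding diff complex_norm_square by simp
    qed
    then have "p * a + q = a * (cnj q * a + cnj p)" using q0 by simp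
    then show "mob p q a = a" using d by (simp add: mob_def)
  qed
qed

text \<open>The fixed points solve a quadratic equation whose roots have product
  \<open>- q / cnj q\<close>, of modulus \<open>1\<close>; two distinct roots cannot both lie in the
  open disc.\<close>

lemma mob_fixed_point_unique:
  assumes lt: "cmod q < cmod p" and q0: "q \<noteq> 0" and a: "cmod a < 1" "mob p q a = a" and b: "cmod b < 1" "mob p q b = b"
  shows "a = b"
proof (rule ccontr)
  assume "a \<noteq> b"
  have eq: "p * z + q = z * (cnj q * z + cnj p)" if "cmod z < 1" "mob p q z = z" for z
    using that mob_denominator_nonzero[OF lt, of z] by (simp add: mob_def field_simps)
  have "a * (cnj q * a + cnj p) - p * a = q" "b * (cnj q * b + cnj p) - p * b = q"
    by (simp_all only: eq[OF a, symmetric] eq[OF b, symmetric] add_diff_cancel_left')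
  moreover have "(a - b) * (cnj q * (a + b) + cnj p - p)
      = (a * (cnj q * a + cnj p) - p * a) - (b * (cnj q * b + cnj p) - p * b)"
    by (simp add: algebra_simps)
  ultimately have "(a - b) * (cnj q * (a + b) + cnj p - p) = 0" by simp
  then have "cnj q * (a + b) + cnj p = p"
    using \<open>a \<noteq> b\<close> by (simp only: mult_eq_0_iff right_minus_eq) blast
  then have "p - cnj p = cnj q * (a + b)" by (metis add_diff_cancel_right')
  moreover have "q = a * (cnj q * a - (p - cnj p))" using eq[OF a] by (simp add: algebra_simps)
  ultimately have "q = a * (cnj q * a - cnj q * (a + b))" by simp
  also have "\<dots> = - (cnj q * (a * b))" by (simp add: algebra_simps)
  finally have "q = - (cnj q * (a * b))" .
  then have "cmod q = cmod q * cmod (a * b)" by (metis norm_minus_cancel norm_mult complex_mod_cnj)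
  then have "cmod (a * b) = 1" using q0 by simp
  moreover have "cmod (a * b) < 1 * 1" unfolding norm_mult using a b by (intro mult_strict_mono) auto
  ultimately show False by simp
qed

lemma involution_automorphism_order:
  assumes "\<And>z. cmod z < 1 \<Longrightarrow> \<phi> (\<phi> z) = z" and "\<phi> 0 \<noteq> 0"
  shows "automorphism_order \<phi> = 2"
proof -
  have two: "(0::nat) < 2 \<and> (\<forall>z\<in>unit_disc. (\<phi> ^^ 2) z = z)"
    using assms(1) by (simp add: numeral_2_eq_2)
  have "(LEAST n. 0 < n \<and> (\<forall>z\<in>unit_disc. (\<phi> ^^ n) z = z)) = 2"
  proof (rule Least_equality, rule two)
    fix n assume n: "0 < n \<and> (\<forall>z\<in>unit_disc. (\<phi> ^^ n) z = z)"
    have "n \<noteq> 1"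
    proof
      assume "n = 1"
      with n have "\<phi> 0 = 0" by auto
      with assms(2) show False by simp
    qed
    with n show "2 \<le> n" by linarith
  qed
  moreover have "\<exists>n>0. \<forall>z\<in>unit_disc. (\<phi> ^^ n) z = z" using two by blast
  ultimately show ?thesis by (simp add: automorphism_order_def numeral_eq_enat)
qed

lemma automorphism_order_2_imp_involution:
  assumes "automorphism_order \<phi> = 2" "cmod z < 1"
  shows "\<phi> (\<phi> z) = z"
proof -
  have ex: "\<exists>n. 0 < n \<and> (\<forall>z\<in>unit_disc. (\<phi> ^^ n) z = z)"
    using assms(1) by (auto simp: automorphism_order_def split: if_splits)
  then have "enat (LEAST n. 0 < n \<and> (\<forall>z\<in>unit_disc. (\<phi> ^^ n) z = z)) = enat 2"
    using assms(1) by (simp add: automorphism_order_def numeral_eq_enat)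
  then have "(LEAST n. 0 < n \<and> (\<forall>z\<in>unit_disc. (\<phi> ^^ n) z = z)) = 2" by simp
  with LeastI_ex[OF ex] have "\<forall>z\<in>unit_disc. (\<phi> ^^ 2) z = z" by simp
  with assms(2) show ?thesis by (simp add: numeral_2_eq_2)
qed

theorem corollary3p6:
  fixes \<phi> :: "complex \<Rightarrow> complex"
  assumes "disc_automorphism \<phi>"
  shows "complex_symmetric_on hardy2 hardy2_inner (composition_operator \<phi>) \<longleftrightarrow>
         disc_rotation \<phi> \<or> (elliptic_automorphism \<phi> \<and> automorphism_order \<phi> = 2)"
proof -
  obtain p q where pq: "(cmod p)\<^sup>2 - (cmod q)\<^sup>2 = 1" and \<phi>: "\<And>z. cmod z < 1 \<Longrightarrow> \<phi> z = mob p q z"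
    using disc_automorphism_mob[OF assms] by blast
  have lt: "cmod q < cmod p" by (rule power_less_imp_less_base[of _ 2]) (use pq in auto)
  then have p0: "p \<noteq> 0" by auto
  have \<phi>\<phi>: "\<phi> (\<phi> z) = mob p q (mob p q z)" if "cmod z < 1" for z
    using that norm_mob_less_1[OF lt that] by (simp add: \<phi>)
  have rot: "disc_rotation \<phi>" if "q = 0"
    unfolding disc_rotation_def
  proof (intro exI conjI ballI)
    show "cmod (p / cnj p) = 1" using p0 by (simp add: norm_divide)
    show "\<phi> z = p / cnj p * z" if "z \<in> unit_disc" for z
      using that \<phi>[of z] \<open>q = 0\<close> by (simp add: mob_def)
  qed
  have iff: "complex_symmetric_on hardy2 hardy2_inner (composition_operator \<phi>) \<longleftrightarrow>
    (\<exists>C S. conjugation_l2 C \<and> (\<forall>x y. cip (comp_l2 p q x) y = cip x (S y)) \<and>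
       (\<forall>x. comp_l2 p q x = C (S (C x))))"
    by (rule complex_symmetric_iff_l2[OF lt]) (rule \<phi>)
  show ?thesis
    unfolding iff
  proof
    assume "\<exists>C S. conjugation_l2 C \<and> (\<forall>x y. cip (comp_l2 p q x) y = cip x (S y)) \<and>
      (\<forall>x. comp_l2 p q x = C (S (C x)))"
    then obtain C S where C: "conjugation_l2 C" "\<And>x y. cip (comp_l2 p q x) y = cip x (S y)"
      "\<And>x. comp_l2 p q x = C (S (C x))" by blast
    show "disc_rotation \<phi> \<or> (elliptic_automorphism \<phi> \<and> automorphism_order \<phi> = 2)"
    proof (cases "q = 0")
      case True
      then show ?thesis using rot by blast
    next
      case False
      have "\<bar>Re p\<bar> < 1"
        by (rule ccontr) (rule nonelliptic_not_complex_symmetric[OF pq False _ C], simp)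
      then obtain a where a: "cmod a < 1" "a \<noteq> 0" "mob p q a = a"
        using mob_elliptic_fixed_point[OF pq False] by blast
      have "\<phi> (\<phi> z) = z" if "cmod z < 1" for z
        unfolding \<phi>\<phi>[OF that] by (rule elliptic_complex_symmetric_imp_involution[OF lt a C that])
      moreover have "\<phi> 0 \<noteq> 0" using False p0 by (simp add: \<phi> mob_def)
      ultimately have "automorphism_order \<phi> = 2" by (rule involution_automorphism_order)
      moreover have "elliptic_automorphism \<phi>"
        unfolding elliptic_automorphism_def
        using assms a mob_fixed_point_unique[OF lt False] by (auto simp: \<phi> intro!: ex1I[of _ a])
      ultimately show ?thesis by blast
    qed
  next
    assume "disc_rotation \<phi> \<or> (elliptic_automorphism \<phi> \<and> automorphism_order \<phi> = 2)"
    \<comment> \<open>For \<open>q = 0\<close> the map is a rotation, so the order two case may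
      assume \<open>q\<close> nonzero.\<close>
    then consider "disc_rotation \<phi>" | "q \<noteq> 0" "automorphism_order \<phi> = 2"
      using rot by blast
    then show "\<exists>C S. conjugation_l2 C \<and> (\<forall>x y. cip (comp_l2 p q x) y = cip x (S y)) \<and>
      (\<forall>x. comp_l2 p q x = C (S (C x)))"
    proof cases
      case 1
      then obtain \<zeta> where "cmod \<zeta> = 1" "\<And>z. cmod z < 1 \<Longrightarrow> mob p q z = \<zeta> * z"
        unfolding disc_rotation_def by (auto simp: \<phi>)
      then show ?thesis by (intro complex_symmetric_rotation[OF lt]) auto
    next
      case 2
      \<comment> \<open>The involution property at the single point \<open>0\<close> already forces
        the trace \<open>p + cnj p\<close> to vanish.\<close>
      have "mob p q (mob p q 0) = 0"
        using automorphism_order_2_imp_involution[OF 2(2), of 0] \<phi>\<phi>[of 0] by simp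
      then have "p * mob p q 0 + q = 0"
        using mob_denominator_nonzero[OF lt, of "mob p q 0"] norm_mob_less_1[OF lt, of 0]
        by (simp add: mob_def[of p q "mob p q 0"])
      then have "q * (p + cnj p) = 0" using p0 by (simp add: mob_def field_simps)
      then have "p + cnj p = 0" using 2(1) by simp
      then show ?thesis by (rule complex_symmetric_involution[OF lt 2(1)])
    qed
  qed
qed

end
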